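(* Let $P,f,\mathfrak K,M,K,\alpha,\beta$ be the data fixed in the context. Then there exists a $P$-module homomorphism $X:M_1\to M_2$ such that (a) $X\circ\alpha_1=0$, (b) $m_2\circ X=\beta_0(1)\cdot \mathrm{id}_{M_1}-\alpha_1\circ\beta_1$, (c) $X\circ m_2+m_3\circ X^\dagger=\beta_0(1)\cdot\mathrm{id}_{M_2}-\alpha_2\circ\beta_2$, (d) $X^\dagger\circ X=0$, and (e) $X^\dagger\circ\alpha_2=0$.
   Context: **DG$\Gamma$-algebras.** A DG-algebra $F$ over a commutative Noetherian ring $P$ is a complex of finitely generated free $P$-modules $\cdots\to F_1\xrightarrow{d_1}F_0=P$ with a unitary associative multiplication satisfying $F_iF_j\subseteq F_{i+j}$, $d(x_ix_j)=d(x_i)x_j+(-1)^ix_id(x_j)$, $x_ix_j=(-1)^{ij}x_jx_i$, and $x_i^2=0$ for $i$ odd ($x_\ell\in F_\ell$). It is a DG$\Gamma$-algebra if each $x_i\in F_i$ with $i$ positive and even has divided powers $x_i^{(k)}\in F_{ik}$ satisfying the usual divided power axioms and $d(x_i^{(k)})=d(x_i)x_i^{(k-1)}$. It exhibits Poincaré duality if for some $m$ one has $F_i=0$ for $i>m$, $F_m\cong P$, and each multiplication map $F_i\otimes_PF_{m-i}\to F_m$ is a perfect pairing. **Data.** $P$ is a commutative Noetherian ring, $f$ is a regular element (non-zero-divisor) of $P$, $\mathfrak K$ is an ideal of $P$ generated by a regular sequence of length four, and $$M:\ 0\to M_4\xrightarrow{m_4}M_3\xrightarrow{m_3}M_2\xrightarrow{m_2}M_1\xrightarrow{m_1}M_0=P$$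 is a resolution of $P/(\mathfrak K:f)$ by free $P$-modules such that $M$ is a DG$\Gamma$-algebra which exhibits Poincaré duality, and $M_1=M_{1,1}\oplus M_{1,2}$ is a direct sum of two free submodules with $\mathrm{rank}\,M_{1,1}=4$ and $m_1(M_{1,1})=\mathfrak K$. **The maps $\alpha$ and $\beta$.** $K:\ 0\to K_4\xrightarrow{k_4}K_3\xrightarrow{k_3}K_2\xrightarrow{k_2}K_1\xrightarrow{k_1}K_0=P$ is the Koszul complex which is a resolution of $P/\mathfrak K$ (a DG$\Gamma$-algebra with Poincaré duality; its product is written $\wedge$). Fix orientation isomorphisms $[-]_K:K_4\to P$ and $[-]_M:M_4\to P$. Let $\alpha_0:K_0=P\to M_0=P$ be the identity, and let $\alpha_1:K_1\to M_1$ be such that $\mathrm{proj}_{M_{1,1}}\circ\alpha_1:K_1\to M_{1,1}$ is the (fixed) isomorphism with $m_1|_{M_{1,1}}\circ\mathrm{proj}_{M_{1,1}}\circ\alpha_1=k_1$, and $\mathrm{proj}_{M_{1,2}}\circ\alpha_1=0$. Let $\alpha:K\to M$ be the map of DG$\Gamma$-algebras which extends $\alpha_0$ and $\alpha_1$. Define $\beta_i:M_i\to K_i$ by $[\beta_i(\theta_i)\wedge\phi_{4-i}]_K=[\theta_i\cdot\alpha_{4-i}(\phi_{4-i})]_M$ for all $\theta_i\in M_i$, $\phi_{4-i}\in K_{4-i}$. In particular $\beta_0(1)\in K_0=P$. **The adjoint.** For a homomorphism $h:M_1\to M_2$, $h^\dagger:M_2\to M_3$ is defined by $h^\dagger(\theta_2)\cdot\theta_1=\theta_2\cdot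 h(\theta_1)$ in $M_4$ for all $\theta_i\in M_i$. *)

theory Defs
  imports Complex_Main
begin

section \<open>Commutative algebra over the base ring\<close>

text \<open>The base ring \<open>P\<close> is a type of class \<^class>\<open>comm_ring_1\<close>, viewed as a module over itself
  by multiplication; its ideals are the submodules of that module.\<close>

definition ideal_gen :: "'a::comm_ring_1 set \<Rightarrow> 'a set" where
  "ideal_gen S = module.span (*) S"

definition noetherian_base :: "'a::comm_ring_1 itself \<Rightarrow> bool" where
  "noetherian_base _ \<longleftrightarrow>
     (\<forall>I :: 'a set. module.subspace (*) I \<longrightarrow> (\<exists>S. finite S \<and> I = ideal_gen S))"

definition regular_element :: "'a::comm_ring_1 \<Rightarrow> bool" where
  "regular_element f \<longleftrightarrow> (\<forall>x. f * x = 0 \<longrightarrow> x = 0)"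

definition regular_sequence :: "'a::comm_ring_1 list \<Rightarrow> bool" where
  "regular_sequence xs \<longleftrightarrow>
     (\<forall>i<length xs. \<forall>y. xs ! i * y \<in> ideal_gen (set (take i xs))
                       \<longrightarrow> y \<in> ideal_gen (set (take i xs)))
     \<and> ideal_gen (set xs) \<noteq> UNIV"

definition colon :: "'a::comm_ring_1 set \<Rightarrow> 'a \<Rightarrow> 'a set" where
  "colon I f = {x. f * x \<in> I}"

section \<open>Homomorphisms between submodules\<close>

text \<open>Functions are total, but only their values on the domain \<open>A\<close> are constrained.\<close>

definition hom_on ::
  "('a::comm_ring_1 \<Rightarrow> 'b::ab_group_add \<Rightarrow> 'b) \<Rightarrow> 'b set \<Rightarrow>
   ('a \<Rightarrow> 'c::ab_group_add \<Rightarrow> 'c) \<Rightarrow> 'c set \<Rightarrow> ('b \<Rightarrow> 'c) \<Rightarrow> bool" where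
  "hom_on s1 A s2 B h \<longleftrightarrow>
     (\<forall>x\<in>A. h x \<in> B) \<and>
     (\<forall>x\<in>A. \<forall>y\<in>A. h (x + y) = h x + h y) \<and>
     (\<forall>r. \<forall>x\<in>A. h (s1 r x) = s2 r (h x))"

definition iso_on ::
  "('a::comm_ring_1 \<Rightarrow> 'b::ab_group_add \<Rightarrow> 'b) \<Rightarrow> 'b set \<Rightarrow>
   ('a \<Rightarrow> 'c::ab_group_add \<Rightarrow> 'c) \<Rightarrow> 'c set \<Rightarrow> ('b \<Rightarrow> 'c) \<Rightarrow> bool" where
  "iso_on s1 A s2 B h \<longleftrightarrow> hom_on s1 A s2 B h \<and> bij_betw h A B"

definition free_of_rank ::
  "('a::comm_ring_1 \<Rightarrow> 'b::ab_group_add \<Rightarrow> 'b) \<Rightarrow> 'b set \<Rightarrow> nat \<Rightarrow> bool" where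
  "free_of_rank s A n \<longleftrightarrow>
     (\<exists>B. finite B \<and> card B = n \<and> \<not> module.dependent s B \<and> module.span s B = A)"

definition direct_sum2 :: "'b::ab_group_add set \<Rightarrow> 'b set \<Rightarrow> 'b set \<Rightarrow> bool" where
  "direct_sum2 C A B \<longleftrightarrow> C = {a + b | a b. a \<in> A \<and> b \<in> B} \<and> A \<inter> B = {0}"

text \<open>The projection onto \<open>A\<close> along \<open>B\<close>, for a direct sum of \<open>A\<close> and \<open>B\<close>.\<close>

definition proj_onto :: "'b::ab_group_add set \<Rightarrow> 'b set \<Rightarrow> 'b \<Rightarrow> 'b" where
  "proj_onto A B x = (THE a. a \<in> A \<and> x - a \<in> B)"

section \<open>DG-algebras and divided powers\<close>

text \<open>A DG-algebra is carried by the total module \<open>\<Oplus>\<^sub>i F i\<close>, a ring type; \<open>F i\<close> is the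
  submodule of elements of degree \<open>i\<close>, and all components \<open>d\<^sub>i\<close> of the differential
  are restrictions of one endomorphism \<open>d\<close>. The equality \<open>F\<^sub>0 = P\<close> is the identification of
  \<open>p\<close> with \<open>p *s 1\<close>.\<close>

locale dg_algebra = module scale
  for scale :: "'a::comm_ring_1 \<Rightarrow> 'm::ring_1 \<Rightarrow> 'm" (infixr "*s" 75) +
  fixes F :: "nat \<Rightarrow> 'm set" and d :: "'m \<Rightarrow> 'm"
  assumes mult_scale_left: "(r *s x) * y = r *s (x * y)"
    and mult_scale_right: "x * (r *s y) = r *s (x * y)"
    and free: "\<exists>n. free_of_rank scale (F i) n"
    and direct: "\<exists>!c. (\<forall>i. c i \<in> F i) \<and> finite {i. c i \<noteq> 0} \<and> x = (\<Sum>i | c i \<noteq> 0. c i)"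
    and degree_0: "F 0 = range (\<lambda>r. r *s 1)"
    and scale_one_inj: "inj (\<lambda>r. r *s (1::'m))"
    and d_hom: "module_hom scale scale d"
    and d_Suc: "x \<in> F (Suc i) \<Longrightarrow> d x \<in> F i"
    and d_0: "x \<in> F 0 \<Longrightarrow> d x = 0"
    and d_d: "d (d x) = 0"
    and mult_degree: "x \<in> F i \<Longrightarrow> y \<in> F j \<Longrightarrow> x * y \<in> F (i + j)"
    and leibniz: "x \<in> F i \<Longrightarrow> y \<in> F j \<Longrightarrow> d (x * y) = d x * y + (-1) ^ i * (x * d y)"
    and graded_comm: "x \<in> F i \<Longrightarrow> y \<in> F j \<Longrightarrow> x * y = (-1) ^ (i * j) * (y * x)"
    and odd_square: "x \<in> F i \<Longrightarrow> odd i \<Longrightarrow> x * x = 0"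

text \<open>\<open>dp n x\<close> is the divided power \<open>x\<^sup>(\<^sup>n\<^sup>)\<close>; only its values on homogeneous \<open>x\<close> of positive
  even degree matter. The axioms are those of Gulliksen and Levin.\<close>

locale dgGamma_algebra = dg_algebra scale F d
  for scale :: "'a::comm_ring_1 \<Rightarrow> 'm::ring_1 \<Rightarrow> 'm" (infixr "*s" 75)
    and F :: "nat \<Rightarrow> 'm set" and d :: "'m \<Rightarrow> 'm" +
  fixes dp :: "nat \<Rightarrow> 'm \<Rightarrow> 'm"
  assumes dp_degree: "x \<in> F i \<Longrightarrow> even i \<Longrightarrow> 0 < i \<Longrightarrow> dp n x \<in> F (n * i)"
    and dp_0: "x \<in> F i \<Longrightarrow> even i \<Longrightarrow> 0 < i \<Longrightarrow> dp 0 x = 1"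
    and dp_1: "x \<in> F i \<Longrightarrow> even i \<Longrightarrow> 0 < i \<Longrightarrow> dp 1 x = x"
    and dp_mult: "x \<in> F i \<Longrightarrow> even i \<Longrightarrow> 0 < i \<Longrightarrow>
      dp p x * dp q x = of_nat ((p + q) choose p) * dp (p + q) x"
    and dp_add: "x \<in> F i \<Longrightarrow> y \<in> F i \<Longrightarrow> even i \<Longrightarrow> 0 < i \<Longrightarrow>
      dp n (x + y) = (\<Sum>j\<le>n. dp j x * dp (n - j) y)"
    and dp_prod_even: "x \<in> F i \<Longrightarrow> y \<in> F j \<Longrightarrow> even i \<Longrightarrow> even j \<Longrightarrow> 0 < j \<Longrightarrow>
      dp n (x * y) = x ^ n * dp n y"
    and dp_prod_odd: "x \<in> F i \<Longrightarrow> y \<in> F j \<Longrightarrow> odd i \<Longrightarrow> odd j \<Longrightarrow> 2 \<le> n \<Longrightarrow>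
      dp n (x * y) = 0"
    and dp_dp: "x \<in> F i \<Longrightarrow> even i \<Longrightarrow> 0 < i \<Longrightarrow> 0 < p \<Longrightarrow>
      dp q (dp p x) = of_nat (fact (p * q) div (fact q * fact p ^ q)) * dp (p * q) x"
    and d_dp: "x \<in> F i \<Longrightarrow> even i \<Longrightarrow> 0 < i \<Longrightarrow> 0 < n \<Longrightarrow>
      d (dp n x) = d x * dp (n - 1) x"

text \<open>The identification of the degree-0 component \<open>F\<^sub>0 = P\<close> with the base ring.\<close>

definition scalar_of :: "('a::comm_ring_1 \<Rightarrow> 'm::ring_1 \<Rightarrow> 'm) \<Rightarrow> 'm \<Rightarrow> 'a" where
  "scalar_of s x = (THE r. s r 1 = x)"

text \<open>Exactness of \<open>\<dots> \<rightarrow> F\<^sub>1 \<rightarrow> F\<^sub>0 = P \<rightarrow> P/I \<rightarrow> 0\<close>; freeness of the \<open>F\<^sub>i\<close> is part of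
  \<^locale>\<open>dg_algebra\<close>.\<close>

definition resolves ::
  "('a::comm_ring_1 \<Rightarrow> 'm::ring_1 \<Rightarrow> 'm) \<Rightarrow> (nat \<Rightarrow> 'm set) \<Rightarrow> ('m \<Rightarrow> 'm) \<Rightarrow> 'a set \<Rightarrow> bool" where
  "resolves s F d I \<longleftrightarrow>
     (\<forall>i\<ge>1. {x \<in> F i. d x = 0} = d ` F (Suc i)) \<and> d ` F 1 = (\<lambda>r. s r 1) ` I"

definition perfect_pairing ::
  "('a::comm_ring_1 \<Rightarrow> 'm::ring_1 \<Rightarrow> 'm) \<Rightarrow> 'm set \<Rightarrow> 'm set \<Rightarrow> 'm set \<Rightarrow> bool" where
  "perfect_pairing s A B C \<longleftrightarrow>
     (\<forall>\<phi>. hom_on s B s C \<phi> \<longrightarrow> (\<exists>!a. a \<in> A \<and> (\<forall>b\<in>B. \<phi> b = a * b))) \<and>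
     (\<forall>\<phi>. hom_on s A s C \<phi> \<longrightarrow> (\<exists>!b. b \<in> B \<and> (\<forall>a\<in>A. \<phi> a = a * b)))"

definition poincare_duality ::
  "('a::comm_ring_1 \<Rightarrow> 'm::ring_1 \<Rightarrow> 'm) \<Rightarrow> (nat \<Rightarrow> 'm set) \<Rightarrow> bool" where
  "poincare_duality s F \<longleftrightarrow>
     (\<exists>m. (\<forall>i>m. F i = {0}) \<and> (\<exists>h. iso_on s (F m) (*) UNIV h) \<and>
          (\<forall>i\<le>m. perfect_pairing s (F i) (F (m - i)) (F m)))"

text \<open>The underlying algebra of the Koszul complex is the exterior algebra on \<open>F\<^sub>1\<close>, free of
  rank \<open>n\<close> with basis \<open>es\<close>: the monomials \<open>e\<^sub>S = e\<^bsub>s\<^sub>1\<^esub> \<and> \<dots> \<and> e\<^bsub>s\<^sub>p\<^esub>\<close> with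
  \<open>S = {s\<^sub>1 < \<dots> < s\<^sub>p}\<close> form a basis. The Leibniz rule then makes \<open>d\<close> the Koszul
  differential of \<open>d\<^sub>1\<close>, and the axioms determine the divided powers.\<close>

definition koszul_complex ::
  "nat \<Rightarrow> ('a::comm_ring_1 \<Rightarrow> 'm::ring_1 \<Rightarrow> 'm) \<Rightarrow> (nat \<Rightarrow> 'm set) \<Rightarrow> ('m \<Rightarrow> 'm) \<Rightarrow>
   (nat \<Rightarrow> 'm \<Rightarrow> 'm) \<Rightarrow> bool" where
  "koszul_complex n s F d dp \<longleftrightarrow>
     dgGamma_algebra s F d dp \<and>
     (\<exists>es. length es = n \<and> set es \<subseteq> F 1 \<and>
        inj_on (\<lambda>S. prod_list (nths es S)) (Pow {..<n}) \<and>
        \<not> module.dependent s ((\<lambda>S. prod_list (nths es S)) ` Pow {..<n}) \<and>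
        module.span s ((\<lambda>S. prod_list (nths es S)) ` Pow {..<n}) = UNIV)"

text \<open>Multiplicativity together with \<open>h 1 = 1\<close> and linearity says that \<open>h\<close> is the identity of
  \<open>P\<close> in degree 0.\<close>

definition dgGamma_hom ::
  "('a::comm_ring_1 \<Rightarrow> 'k::ring_1 \<Rightarrow> 'k) \<Rightarrow> (nat \<Rightarrow> 'k set) \<Rightarrow> ('k \<Rightarrow> 'k) \<Rightarrow> (nat \<Rightarrow> 'k \<Rightarrow> 'k) \<Rightarrow>
   ('a \<Rightarrow> 'm::ring_1 \<Rightarrow> 'm) \<Rightarrow> (nat \<Rightarrow> 'm set) \<Rightarrow> ('m \<Rightarrow> 'm) \<Rightarrow> (nat \<Rightarrow> 'm \<Rightarrow> 'm) \<Rightarrow>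
   ('k \<Rightarrow> 'm) \<Rightarrow> bool" where
  "dgGamma_hom s F d dp s' F' d' dp' h \<longleftrightarrow>
     module_hom s s' h \<and> (\<forall>i. h ` F i \<subseteq> F' i) \<and> h 1 = 1 \<and>
     (\<forall>x y. h (x * y) = h x * h y) \<and> (\<forall>x. h (d x) = d' (h x)) \<and>
     (\<forall>i n. \<forall>x\<in>F i. even i \<and> 0 < i \<longrightarrow> h (dp n x) = dp' n (h x))"

text \<open>The adjoint \<open>h\<^sup>\<dagger> : F\<^sub>2 \<rightarrow> F\<^sub>3\<close> of \<open>h : F\<^sub>1 \<rightarrow> F\<^sub>2\<close>, for \<open>F\<close> with Poincare duality and
  top degree 4; see \<open>dagger_unique\<close> for its well-definedness.\<close>

definition dagger :: "(nat \<Rightarrow> 'm::ring_1 set) \<Rightarrow> ('m \<Rightarrow> 'm) \<Rightarrow> 'm \<Rightarrow> 'm" where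
  "dagger F h \<theta>2 = (THE \<theta>3. \<theta>3 \<in> F 3 \<and> (\<forall>\<theta>1\<in>F 1. \<theta>3 * \<theta>1 = \<theta>2 * h \<theta>1))"

lemma (in dg_algebra) dagger_unique:
  assumes "perfect_pairing scale (F 3) (F 1) (F 4)"
    and h: "hom_on scale (F 1) scale (F 2) h" and t: "\<theta>2 \<in> F 2"
  shows "\<exists>!\<theta>3. \<theta>3 \<in> F 3 \<and> (\<forall>\<theta>1\<in>F 1. \<theta>3 * \<theta>1 = \<theta>2 * h \<theta>1)"
proof -
  have "hom_on scale (F 1) scale (F 4) (\<lambda>x. \<theta>2 * h x)"
    using h mult_degree[OF t, of _ 2] unfolding hom_on_def
    by (simp add: distrib_left mult_scale_right)
  then have "\<exists>!\<theta>3. \<theta>3 \<in> F 3 \<and> (\<forall>\<theta>1\<in>F 1. \<theta>2 * h \<theta>1 = \<theta>3 * \<theta>1)"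
    using assms(1) unfolding perfect_pairing_def by blast
  then show ?thesis by (simp add: eq_commute)
qed

end

theory Submission
  imports Defs
begin

text \<open>Write \<open>w\<close> for \<open>\<beta>\<^sub>0(1)\<close>, \<open>[ ]\<close> for the orientations, and let \<open>e\<^sub>1\<close>, \<open>e\<^sub>2\<close> in \<open>K\<^sub>1\<close> be mapped by the differential
  to the first two elements \<open>x\<^sub>1\<close>, \<open>x\<^sub>2\<close> of the regular sequence that generates \<open>KK\<close>;
  put \<open>a\<^sub>i = \<alpha>(e\<^sub>i)\<close>. The map \<open>\<beta>\<close> is a chain map, because up to sign each
  differential is its own adjoint for the duality pairings, and \<open>\<beta> \<circ> \<alpha> = w\<close>, because \<open>\<alpha>\<close> is
  multiplicative and equals \<open>w\<close> in degree four. The five conditions reduce to two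
  properties of \<open>X\<close>, which are achieved one after the other.

  The first property is that \<open>X\<close> vanishes on \<open>\<alpha>(K\<^sub>1)\<close>, satisfies \<open>m X = w - \<alpha>\<beta>\<close> and has
  \<open>\<beta>\<^sub>2 X = 0\<close>. It contains (a) and (b), and it gives (e): \<open>X\<^sup>\<dagger>\<alpha>\<^sub>2 = 0\<close> and \<open>\<beta>\<^sub>2 X = 0\<close> are
  both the vanishing of \<open>[X\<theta> \<cdot> \<alpha>\<phi>]\<close>. Such an \<open>X\<close> exists by lifting \<open>w - \<alpha>\<beta>\<close> along
  \<open>m\<^sub>2\<close> on a basis of \<open>M\<^sub>1\<^sub>,\<^sub>2\<close>: any lift \<open>x\<close> has \<open>\<beta>\<^sub>2 x\<close> in the kernel, hence in the image, of the
  differential of \<open>K\<close>, and as \<open>\<beta>\<^sub>3\<close> is surjective (it is dual to the split injection \<open>\<alpha>\<^sub>1\<close>), a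
  boundary of \<open>M\<close> corrects \<open>x\<close> to have \<open>\<beta>\<^sub>2 x = 0\<close> (lemma \<open>lift_pointwise\<close>).

  Condition (c) says that the symmetric bilinear form
  \<open>E(x,y) = w[xy] - [\<beta>x \<beta>y] - [X(mx) y] - [X(my) x]\<close> on \<open>M\<^sub>2\<close> vanishes. It vanishes when one argument
  is a boundary, and \<open>x\<^sub>1 x\<close> differs from \<open>a\<^sub>1 \<cdot> mx\<close> by a boundary. Hence
  \<open>x\<^sub>1\<^sup>2 E(x,y) = E(a\<^sub>1 u, a\<^sub>1 v)\<close> with \<open>u = mx\<close> and \<open>v = my\<close>, and this is \<open>-x\<^sub>1(s(u,v) + s(v,u))\<close> for
  \<open>s(u,v) = [a\<^sub>1 u Xv]\<close>, the other terms being zero since \<open>a\<^sub>1 a\<^sub>1 = 0\<close> and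
  \<open>e\<^sub>1 e\<^sub>1 = 0\<close>. So the second property to achieve is that \<open>s\<close> is skew-symmetric.

  Adding \<open>m Y\<close> to \<open>X\<close>, with \<open>Y : M\<^sub>1 \<rightarrow> M\<^sub>3\<close> vanishing on \<open>\<alpha>(K\<^sub>1)\<close> and with values that annihilate \<open>\<alpha>(K\<^sub>1)\<close>, keeps
  the first property and changes \<open>s(u,v)\<close> by \<open>x\<^sub>1[Yv \<cdot> u]\<close>. By Poincare duality \<open>[Yv \<cdot> u]\<close> is an
  arbitrary bilinear form on \<open>M\<^sub>1/\<alpha>(K\<^sub>1)\<close>, so it suffices that \<open>s(v,v)\<close> is divisible by \<open>x\<^sub>1\<close>: a
  triangular choice of the form on a basis then works, without dividing by 2. The
  divisibility comes from the second generator: expanding \<open>m(a\<^sub>1 a\<^sub>2 v) \<cdot> Xv\<close> in two ways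
  gives \<open>x\<^sub>2[a\<^sub>1 v Xv] = x\<^sub>1[a\<^sub>2 v Xv]\<close>, and \<open>x\<^sub>1, x\<^sub>2\<close> is a regular sequence (lemma
  \<open>a1_form_diagonal\<close>).

  Finally (d) follows from (c) at \<open>X\<theta>\<close>: all terms but \<open>m X\<^sup>\<dagger>X\<theta>\<close> cancel, so \<open>X\<^sup>\<dagger>X\<theta>\<close> is the
  boundary of some \<open>l\<close> in \<open>M\<^sub>4\<close>, and \<open>0 = X\<^sup>\<dagger>X\<theta> \<cdot> a\<^sub>1\<close> is \<open>x\<^sub>1 l\<close> up to sign.\<close>

section \<open>Homogeneous elements of a DG-algebra\<close>

context dg_algebra
begin

lemma F_subspace: "subspace (F i)"
  using free[of i] unfolding free_of_rank_def by (metis subspace_span)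

lemmas F_add = subspace_add[OF F_subspace]
  and F_scale = subspace_scale[OF F_subspace]
  and F_zero = subspace_0[OF F_subspace]
  and F_neg = subspace_neg[OF F_subspace]
  and F_diff = subspace_diff[OF F_subspace]
  and F_sum = subspace_sum[OF F_subspace]

lemma one_degree: "1 \<in> F 0"
  using degree_0 by (metis rangeI scale_one)

lemmas d_simps = module_hom.add[OF d_hom] module_hom.scale[OF d_hom] module_hom.zero[OF d_hom]
  module_hom.neg[OF d_hom] module_hom.diff[OF d_hom] module_hom.sum[OF d_hom]

lemma mult_degree': "x \<in> F i \<Longrightarrow> y \<in> F j \<Longrightarrow> i + j = n \<Longrightarrow> x * y \<in> F n"
  using mult_degree by blast

lemma comm_even: "x \<in> F i \<Longrightarrow> y \<in> F j \<Longrightarrow> even (i * j) \<Longrightarrow> x * y = y * x"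
  using graded_comm[of x i y j] by simp

lemma comm_odd: "x \<in> F i \<Longrightarrow> y \<in> F j \<Longrightarrow> odd (i * j) \<Longrightarrow> x * y = - (y * x)"
  using graded_comm[of x i y j] by simp

lemma leibniz_even: "x \<in> F i \<Longrightarrow> y \<in> F j \<Longrightarrow> even i \<Longrightarrow> d (x * y) = d x * y + x * d y"
  using leibniz[of x i y j] by simp

lemma leibniz_odd: "x \<in> F i \<Longrightarrow> y \<in> F j \<Longrightarrow> odd i \<Longrightarrow> d (x * y) = d x * y - x * d y"
  using leibniz[of x i y j] by simp

text \<open>In degrees where the product vanishes, the Leibniz rule says that \<open>d\<close> is, up to sign,
  its own adjoint.\<close>

lemma d_adjoint_even:
  "x \<in> F i \<Longrightarrow> y \<in> F j \<Longrightarrow> even i \<Longrightarrow> F (i + j) = {0} \<Longrightarrow> d x * y = - (x * d y)"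
  using leibniz_even[of x i y j] mult_degree[of x i y j]
  by (simp add: d_simps eq_neg_iff_add_eq_0)

lemma d_adjoint_odd:
  "x \<in> F i \<Longrightarrow> y \<in> F j \<Longrightarrow> odd i \<Longrightarrow> F (i + j) = {0} \<Longrightarrow> d x * y = x * d y"
  using leibniz_odd[of x i y j] mult_degree[of x i y j] by (simp add: d_simps)

text \<open>Squares of odd elements are zero also when \<open>2\<close> is a zero divisor, so this does not follow from
  graded commutativity alone.\<close>

lemma odd_repeated:
  assumes x: "x \<in> F 1" and u: "u \<in> F 1" shows "x * u * (x * v) = 0"
proof -
  have "x * u * (x * v) = x * (u * x) * v" by (simp only: mult.assoc)
  also have "\<dots> = - (x * x * u * v)"
    using comm_odd[OF u x] by (simp add: mult.assoc)
  finally show ?thesis using odd_square[OF x] by simp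
qed

text \<open>Uniqueness of the homogeneous decomposition, for sums indexed by any finite set of degrees.\<close>

lemma homogeneous_component:
  assumes x: "x \<in> F i" and J: "finite J" and g: "\<And>j. j \<in> J \<Longrightarrow> g j \<in> F j"
    and sum: "x = (\<Sum>j\<in>J. g j)"
  shows "x = (if i \<in> J then g i else 0)"
proof -
  define u where "u j = (if j \<in> J then g j else 0)" for j
  define v where "v j = (if j = i then x else 0)" for j
  have u_supp: "{j. u j \<noteq> 0} \<subseteq> J" and v_supp: "{j. v j \<noteq> 0} \<subseteq> {i}"
    by (auto simp: u_def v_def)
  let ?decomposes = "\<lambda>c. (\<forall>j. c j \<in> F j) \<and> finite {j. c j \<noteq> 0} \<and> x = (\<Sum>j | c j \<noteq> 0. c j)"
  have u: "(\<forall>j. u j \<in> F j) \<and> finite {j. u j \<noteq> 0} \<and> x = (\<Sum>j | u j \<noteq> 0. u j)"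
  proof (intro conjI)
    have "(\<Sum>j | u j \<noteq> 0. u j) = (\<Sum>j\<in>J. u j)"
      by (rule sum.mono_neutral_left[OF J u_supp]) auto
    then show "x = (\<Sum>j | u j \<noteq> 0. u j)" using sum by (simp add: u_def)
    show "finite {j. u j \<noteq> 0}" using finite_subset[OF u_supp J] .
  qed (simp add: u_def g F_zero)
  have v: "(\<forall>j. v j \<in> F j) \<and> finite {j. v j \<noteq> 0} \<and> x = (\<Sum>j | v j \<noteq> 0. v j)"
  proof (intro conjI)
    have "(\<Sum>j | v j \<noteq> 0. v j) = (\<Sum>j\<in>{i}. v j)"
      by (rule sum.mono_neutral_left) (use v_supp in auto)
    then show "x = (\<Sum>j | v j \<noteq> 0. v j)" by (simp add: v_def)
    show "finite {j. v j \<noteq> 0}" using finite_subset[OF v_supp] by simp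
  qed (simp add: v_def x F_zero)
  have "u = v" 
    using the1_equality[of ?decomposes, OF direct u] the1_equality[of ?decomposes, OF direct v]
    by (rule trans[OF sym])
  then have "u i = v i" by simp
  then show ?thesis by (simp add: u_def v_def)
qed

section \<open>Duality on the exterior algebra\<close>

lemma prod_list_degree: "set xs \<subseteq> F 1 \<Longrightarrow> prod_list xs \<in> F (length xs)"
proof (induction xs)
  case (Cons x xs)
  then show ?case using mult_degree[of x 1 "prod_list xs" "length xs"] by simp
qed (simp add: one_degree)

text \<open>The sign is left open: products of monomials are only needed up to sign.\<close>

lemma prod_list_move:
  assumes "x \<in> F 1" "set xs \<subseteq> F 1"
  shows "prod_list xs * (x * y) = x * (prod_list xs * y) \<or>
    prod_list xs * (x * y) = - (x * (prod_list xs * y))"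
proof -
  have "prod_list xs * x = x * prod_list xs \<or> prod_list xs * x = - (x * prod_list xs)"
    using comm_even[OF prod_list_degree[OF assms(2)] assms(1)]
      comm_odd[OF prod_list_degree[OF assms(2)] assms(1)] by blast
  then show ?thesis by (auto simp flip: mult.assoc)
qed

lemma nths_subset: "set es \<subseteq> F 1 \<Longrightarrow> set (nths es S) \<subseteq> F 1"
  using set_nths_subset by fastforce

lemma monomial_mult_overlap:
  assumes "set es \<subseteq> F 1" "i < length es" "i \<in> S" "i \<in> T"
  shows "prod_list (nths es S) * prod_list (nths es T) = 0"
  using assms
proof (induction es arbitrary: S T i)
  case (Cons x es)
  let ?S = "{j. Suc j \<in> S}" and ?T = "{j. Suc j \<in> T}"
  let ?A = "prod_list (nths es ?S)" and ?B = "prod_list (nths es ?T)"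
  have x: "x \<in> F 1" and es: "set es \<subseteq> F 1" using Cons.prems by auto
  note move = prod_list_move[OF x nths_subset[OF es, of ?S], of ?B]
  have xx: "x * (x * z) = 0" for z
    using odd_square[OF x] by (simp flip: mult.assoc)
  show ?case
  proof (cases i)
    case 0
    have "x * (?A * (x * ?B)) = 0" using move xx by auto
    then show ?thesis using 0 Cons.prems by (simp add: nths_Cons mult.assoc)
  next
    case (Suc i')
    then have "?A * ?B = 0" using Cons.IH[OF es, of i' ?S ?T] Cons.prems by simp
    moreover from this have "?A * (x * ?B) = 0" using move by auto
    ultimately show ?thesis by (simp add: nths_Cons mult.assoc)
  qed
qed simp

lemma monomial_mult_complement:
  assumes "set es \<subseteq> F 1"
  shows "prod_list (nths es S) * prod_list (nths es (- S)) = prod_list es \<or>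
    prod_list (nths es S) * prod_list (nths es (- S)) = - prod_list es"
  using assms
proof (induction es arbitrary: S)
  case (Cons x es)
  let ?S = "{j. Suc j \<in> S}"
  let ?A = "prod_list (nths es ?S)" and ?B = "prod_list (nths es (- ?S))"
  have x: "x \<in> F 1" and es: "set es \<subseteq> F 1" using Cons.prems by auto
  have IH: "?A * ?B = prod_list es \<or> ?A * ?B = - prod_list es"
    using Cons.IH[OF es] .
  have nths_compl: "nths (x # es) (- S) = (if 0 \<in> S then [] else [x]) @ nths es (- ?S)"
    by (simp add: nths_Cons Collect_neg_eq)
  have "?A * (x * ?B) = x * (?A * ?B) \<or> ?A * (x * ?B) = - (x * (?A * ?B))"
    by (rule prod_list_move[OF x nths_subset[OF es]])
  then show ?case using IH unfolding nths_compl by (auto simp: nths_Cons mult.assoc)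
qed simp

text \<open>A homogeneous element involves only the basis monomials of its own degree.\<close>

lemma monomial_basis_homogeneous:
  fixes es :: "'m list"
  defines "e \<equiv> \<lambda>S. prod_list (nths es S)"
  assumes es: "length es = n" "set es \<subseteq> F 1" and inj: "inj_on e (Pow {..<n})"
    and span: "span (e ` Pow {..<n}) = UNIV" and x: "x \<in> F i"
  shows "\<exists>c. x = (\<Sum>S | S \<subseteq> {..<n} \<and> card S = i. c S *s e S)"
proof -
  have deg: "e S \<in> F (card S)" if "S \<subseteq> {..<n}" for S
  proof -
    have "{i. i < length es \<and> i \<in> S} = S" using that es(1) by auto
    then show ?thesis
      using prod_list_degree[OF nths_subset[OF es(2)], of S] by (simp add: e_def length_nths)
  qed
  obtain b where "x = (\<Sum>y\<in>e ` Pow {..<n}. b y *s y)"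
    using span span_finite[of "e ` Pow {..<n}"] by auto
  then have x_sum: "x = (\<Sum>S\<in>Pow {..<n}. b (e S) *s e S)"
    by (simp add: sum.reindex[OF inj])
  define g where "g j = (\<Sum>S | S \<subseteq> {..<n} \<and> card S = j. b (e S) *s e S)" for j
  \<comment> \<open>Grouping the monomials by degree gives the homogeneous components of \<open>x\<close>.\<close>
  have "card ` Pow {..<n} \<subseteq> {..n}"
    using card_mono[of "{..<n}"] by auto
  then have "x = (\<Sum>j\<in>{..n}. g j)"
    using sum.group[of "Pow {..<n}" "{..n}" card "\<lambda>S. b (e S) *s e S"] x_sum
    by (simp add: g_def Pow_def Collect_conj_eq)
  then have "x = (if i \<in> {..n} then g i else 0)"
    by (intro homogeneous_component[OF x]) (auto simp: g_def intro!: F_sum F_scale deg)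
  moreover have "g i = 0" if "\<not> i \<le> n"
  proof -
    have "{S. S \<subseteq> {..<n} \<and> card S = i} = {}"
      using that card_mono[of "{..<n}"] by fastforce
    then show ?thesis unfolding g_def by (simp only: sum.empty)
  qed
  ultimately have "x = g i" by (auto split: if_splits)
  then show ?thesis unfolding g_def by (rule exI[of _ "\<lambda>S. b (e S)"])
qed

text \<open>Multiplication by the monomial on the complement of \<open>S\<close> kills every monomial of the same
  degree except \<open>e\<^sub>S\<close>, which it sends to plus or minus the top monomial; so it reads off the
  coefficient of \<open>e\<^sub>S\<close>.\<close>

lemma monomial_basis_nondegenerate:
  fixes es :: "'m list"
  defines "e \<equiv> \<lambda>S. prod_list (nths es S)"
  assumes es: "length es = n" "set es \<subseteq> F 1" and inj: "inj_on e (Pow {..<n})"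
    and ind: "independent (e ` Pow {..<n})"
    and span: "span (e ` Pow {..<n}) = UNIV" and x: "x \<in> F i"
    and i: "i \<le> n" and zero: "\<And>y. y \<in> F (n - i) \<Longrightarrow> x * y = 0"
  shows "x = 0"
proof -
  obtain c where c: "x = (\<Sum>S | S \<subseteq> {..<n} \<and> card S = i. c S *s e S)"
    using monomial_basis_homogeneous[of es n x i] assms by auto
  let ?I = "{S. S \<subseteq> {..<n} \<and> card S = i}"
  have fin: "finite ?I" by (rule finite_subset[of _ "Pow {..<n}"]) auto
  have top: "e {..<n} = prod_list es"
    using es(1) by (simp add: e_def nths_all)
  have "c S = 0" if S: "S \<in> ?I" for S
  proof -
    have compl: "{j. j < length es \<and> j \<notin> S} = {..<n} - S" using es(1) by auto
    have "card ({..<n} - S) = n - i" using S by (auto simp: card_Diff_subset finite_subset)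
    then have "e (- S) \<in> F (n - i)"
      using prod_list_degree[OF nths_subset[OF es(2)], of "- S"]
      by (simp add: e_def length_nths compl)
    then have "0 = x * e (- S)" using zero by simp
    also have "\<dots> = (\<Sum>T\<in>?I. c T *s (e T * e (- S)))"
      by (subst c) (simp add: sum_distrib_right mult_scale_left)
    also have "\<dots> = (\<Sum>T\<in>{S}. c T *s (e T * e (- S)))"
    proof (rule sum.mono_neutral_right[OF fin])
      show "\<forall>T\<in>?I - {S}. c T *s (e T * e (- S)) = 0"
      proof
        fix T assume T: "T \<in> ?I - {S}"
        have "\<not> T \<subseteq> S"
        proof
          assume "T \<subseteq> S"
          moreover have "finite S" using S finite_subset by blast
          ultimately have "T = S" using T S by (intro card_subset_eq) auto
          then show False using T by simp
        qed
        then obtain j where "j \<in> T" "j \<in> - S" by auto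
        then have "e T * e (- S) = 0"
          unfolding e_def using T es
          by (intro monomial_mult_overlap[OF es(2), of j]) auto
        then show "c T *s (e T * e (- S)) = 0" by simp
      qed
    qed (use S in simp)
    finally have "c S *s (e S * e (- S)) = 0" by simp
    then have "c S *s prod_list es = 0"
      using monomial_mult_complement[OF es(2), of S] by (auto simp: e_def)
    then have "c S *s e {..<n} = 0" by (simp only: top)
    then show ?thesis
      using independentD[OF ind, of "{e {..<n}}" "\<lambda>_. c S"] by auto
  qed
  then show ?thesis using c by simp
qed

lemma koszul_top:
  assumes koszul: "koszul_complex n scale F d dp" and i: "n < i"
  shows "F i = {0}"
proof -
  obtain es where es: "length es = n" "set es \<subseteq> F 1"
    "inj_on (\<lambda>S. prod_list (nths es S)) (Pow {..<n})"
    "span ((\<lambda>S. prod_list (nths es S)) ` Pow {..<n}) = UNIV"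
    using koszul unfolding koszul_complex_def by metis
  have "\<not> (S \<subseteq> {..<n} \<and> card S = i)" for S
    using i card_mono[of "{..<n}" S] by auto
  then have empty: "{S. S \<subseteq> {..<n} \<and> card S = i} = {}" by simp
  have "x = 0" if x: "x \<in> F i" for x
    using monomial_basis_homogeneous[OF es x] unfolding empty by simp
  then show ?thesis using F_zero[of i] by blast
qed

lemma koszul_nondegenerate:
  assumes koszul: "koszul_complex n scale F d dp" and i: "i \<le> n" and x: "x \<in> F i"
    and zero: "\<And>y. y \<in> F (n - i) \<Longrightarrow> x * y = 0"
  shows "x = 0"
proof -
  obtain es where es: "length es = n" "set es \<subseteq> F 1"
    "inj_on (\<lambda>S. prod_list (nths es S)) (Pow {..<n})"
    "independent ((\<lambda>S. prod_list (nths es S)) ` Pow {..<n})"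
    "span ((\<lambda>S. prod_list (nths es S)) ` Pow {..<n}) = UNIV"
    using koszul unfolding koszul_complex_def by metis
  show ?thesis by (rule monomial_basis_nondegenerate[OF es x i zero])
qed

end

section \<open>Submodules, regular sequences and the length of a Poincare duality algebra\<close>

lemma hom_on_lincomb:
  assumes h: "hom_on s1 A s2 C h" and s1: "module s1" and s2: "module s2"
    and A: "module.subspace s1 A" and f: "\<And>j. j \<in> J \<Longrightarrow> f j \<in> A"
  shows "h (\<Sum>j\<in>J. s1 (r j) (f j)) = (\<Sum>j\<in>J. s2 (r j) (h (f j)))"
proof -
  interpret s1: module s1 by fact
  interpret s2: module s2 by fact
  have zero: "h 0 = 0"
    using h s1.subspace_0[OF A] unfolding hom_on_def by (metis s1.scale_zero_left s2.scale_zero_left)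
  have in_A: "(\<Sum>j\<in>J'. s1 (r j) (f j)) \<in> A" if "J' \<subseteq> J" for J'
    using that f by (intro s1.subspace_sum[OF A] s1.subspace_scale[OF A]) auto
  have "h (\<Sum>j\<in>J'. s1 (r j) (f j)) = (\<Sum>j\<in>J'. s2 (r j) (h (f j)))" if "J' \<subseteq> J" for J'
    using that
  proof (induction J' rule: infinite_finite_induct)
    case (insert j J')
    have "h (s1 (r j) (f j) + (\<Sum>j\<in>J'. s1 (r j) (f j)))
        = h (s1 (r j) (f j)) + h (\<Sum>j\<in>J'. s1 (r j) (f j))"
      using h in_A[of J'] s1.subspace_scale[OF A f] insert.prems unfolding hom_on_def by simp
    then show ?case using h f insert unfolding hom_on_def by simp
  qed (simp_all add: zero)
  then show ?thesis by simp
qed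

text \<open>Relates the descriptive definition of the projection to an explicit decomposition.\<close>

lemma proj_onto_eq:
  assumes "module s" and A: "module.subspace s A" and B: "module.subspace s B"
    and AB: "A \<inter> B = {0}" and a: "a \<in> A" and b: "b \<in> B"
  shows "proj_onto A B (a + b) = a"
  unfolding proj_onto_def
proof (rule the_equality)
  interpret module s by fact
  show "a \<in> A \<and> a + b - a \<in> B" using a b by simp
  fix a' assume a': "a' \<in> A \<and> a + b - a' \<in> B"
  have "a - a' = a + b - a' - b" by simp
  then have "a - a' \<in> A \<inter> B"
    using a a' b subspace_diff[OF A] subspace_diff[OF B] by (metis IntI)
  then show "a' = a" using AB by auto
qed

lemma regular_sequence_two:
  fixes xs :: "'a::comm_ring_1 list"
  assumes xs: "regular_sequence xs" and len: "2 \<le> length xs"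
  shows "xs ! 0 * r = 0 \<Longrightarrow> r = 0" and "xs ! 1 * r = xs ! 0 * s \<Longrightarrow> \<exists>t. r = xs ! 0 * t"
proof -
  interpret module "(*) :: 'a \<Rightarrow> 'a \<Rightarrow> 'a"
    by unfold_locales (simp_all add: algebra_simps)
  have reg: "r \<in> ideal_gen (set (take i xs))"
    if "i < length xs" "xs ! i * r \<in> ideal_gen (set (take i xs))" for i r
    using xs that unfolding regular_sequence_def by blast
  show "r = 0" if "xs ! 0 * r = 0"
    using reg[of 0 r] that len by (cases xs) (simp_all add: ideal_gen_def)
  have "take 1 xs = [xs ! 0]" using len by (cases xs) simp_all
  then have "ideal_gen (set (take 1 xs)) = range (\<lambda>t. xs ! 0 * t)"
    by (simp add: ideal_gen_def span_singleton mult.commute)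
  then show "\<exists>t. r = xs ! 0 * t" if "xs ! 1 * r = xs ! 0 * s"
    using reg[of 1 r] that len by auto
qed

text \<open>The socle degree of a Poincare duality algebra is the largest degree with a nonzero component,
  so it can be read off from an orientation in degree \<open>n\<close> and vanishing above \<open>n\<close>.\<close>

lemma poincare_duality_top:
  fixes s :: "'a::comm_ring_1 \<Rightarrow> 'm::ring_1 \<Rightarrow> 'm"
  assumes "poincare_duality s F" and top: "\<And>i. n < i \<Longrightarrow> F i = {0}"
    and h: "iso_on s (F n) (*) UNIV h" and i: "i \<le> n"
  shows "perfect_pairing s (F i) (F (n - i)) (F n)"
proof -
  obtain l h' where l: "\<And>i. l < i \<Longrightarrow> F i = {0}" "iso_on s (F l) (*) UNIV h'"
    "\<And>i. i \<le> l \<Longrightarrow> perfect_pairing s (F i) (F (l - i)) (F l)"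
    using assms(1) unfolding poincare_duality_def by blast
  have nonzero: "F j \<noteq> {0}" if "iso_on s (F j) (*) UNIV g" for j and g :: "'m \<Rightarrow> 'a"
  proof
    assume "F j = {0}"
    then have "(UNIV :: 'a set) = {g 0}"
      using that by (auto simp: iso_on_def bij_betw_def)
    then have "(0 :: 'a) = 1" by (metis UNIV_I singletonD)
    then show False by simp
  qed
  have "l = n"
    using nonzero[OF h] nonzero[OF l(2)] l(1)[of n] top[of l] by (meson linorder_neqE_nat)
  then show ?thesis using l(3) i by blast
qed


section \<open>The comparison maps between the Koszul complex and the resolution\<close>

text \<open>The resolution \<open>M\<close>, the Koszul complex \<open>K\<close> and the maps \<open>\<alpha>\<close> and \<open>\<beta>\<close>, with the data used to
  construct \<open>X\<close>: \<open>w\<close> is the scalar \<open>\<beta>\<^sub>0(1)\<close>; the functions \<open>c b\<close>, for \<open>b\<close> in \<open>B\<close>, are coordinates on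
  \<open>M\<^sub>1/\<alpha>(K\<^sub>1)\<close>, coming from a basis of \<open>M\<^sub>1\<^sub>,\<^sub>2\<close> and extended by zero; \<open>e1\<close> and \<open>e2\<close> lie over the first
  two elements \<open>x1\<close>, \<open>x2\<close> of the regular sequence.\<close>

locale linked_resolution =
  M: dg_algebra sM M m + K: dg_algebra sK K k
  for sM :: "'a::comm_ring_1 \<Rightarrow> 'm::ring_1 \<Rightarrow> 'm" and M m
    and sK :: "'a \<Rightarrow> 'k::ring_1 \<Rightarrow> 'k" and K k +
  fixes orM :: "'m \<Rightarrow> 'a" and orK :: "'k \<Rightarrow> 'a"
    and \<alpha> :: "'k \<Rightarrow> 'm" and \<beta> :: "nat \<Rightarrow> 'm \<Rightarrow> 'k" and w :: 'a
    and B :: "'m set" and c :: "'m \<Rightarrow> 'm \<Rightarrow> 'a"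
    and e1 e2 :: 'k and x1 x2 :: 'a
  assumes M_top: "4 < i \<Longrightarrow> M i = {0}"
    and M_exact: "1 \<le> i \<Longrightarrow> x \<in> M i \<Longrightarrow> m x = 0 \<Longrightarrow> \<exists>y\<in>M (Suc i). m y = x"
    and M_perfect: "i \<le> 4 \<Longrightarrow> perfect_pairing sM (M i) (M (4 - i)) (M 4)"
    and K_top: "4 < i \<Longrightarrow> K i = {0}"
    and K_exact: "1 \<le> i \<Longrightarrow> z \<in> K i \<Longrightarrow> k z = 0 \<Longrightarrow> \<exists>y\<in>K (Suc i). k y = z"
    and K_nondegenerate: "i \<le> 4 \<Longrightarrow> z \<in> K i \<Longrightarrow> (\<And>y. y \<in> K (4 - i) \<Longrightarrow> z * y = 0) \<Longrightarrow> z = 0"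
    and orM: "iso_on sM (M 4) (*) UNIV orM"
    and orK: "iso_on sK (K 4) (*) UNIV orK"
    and \<alpha>_linear: "module_hom sK sM \<alpha>"
    and \<alpha>_degree: "z \<in> K i \<Longrightarrow> \<alpha> z \<in> M i"
    and \<alpha>_one: "\<alpha> 1 = 1"
    and \<alpha>_mult: "\<alpha> (y * z) = \<alpha> y * \<alpha> z"
    and \<alpha>_d: "\<alpha> (k z) = m (\<alpha> z)"
    and \<alpha>_inj: "inj_on \<alpha> (K 1)"
    and \<beta>_degree: "i \<le> 4 \<Longrightarrow> x \<in> M i \<Longrightarrow> \<beta> i x \<in> K i"
    and \<beta>_eq: "i \<le> 4 \<Longrightarrow> x \<in> M i \<Longrightarrow> y \<in> K (4 - i) \<Longrightarrow> orK (\<beta> i x * y) = orM (x * \<alpha> y)"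
    and \<beta>_one: "\<beta> 0 1 = sK w 1"
    and B_finite: "finite B" and B_degree: "B \<subseteq> M 1"
    and c_hom: "b \<in> B \<Longrightarrow> hom_on sM (M 1) (*) UNIV (c b)"
    and c_\<alpha>: "b \<in> B \<Longrightarrow> z \<in> K 1 \<Longrightarrow> c b (\<alpha> z) = 0"
    and c_expand: "v \<in> M 1 \<Longrightarrow> \<exists>z\<in>K 1. v = \<alpha> z + (\<Sum>b\<in>B. sM (c b v) b)"
    and e1: "e1 \<in> K 1" "k e1 = sK x1 1" and e2: "e2 \<in> K 1" "k e2 = sK x2 1"
    and x1_regular: "x1 * r = 0 \<Longrightarrow> r = 0"
    and x2_regular: "x2 * r = x1 * s \<Longrightarrow> \<exists>t. r = x1 * t"
begin

lemmas \<alpha>_simps = module_hom.add[OF \<alpha>_linear] module_hom.scale[OF \<alpha>_linear]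
  module_hom.zero[OF \<alpha>_linear] module_hom.neg[OF \<alpha>_linear] module_hom.diff[OF \<alpha>_linear]

lemmas M_scale = M.mult_scale_left M.mult_scale_right
lemmas K_scale = K.mult_scale_left K.mult_scale_right

abbreviation "a1 \<equiv> \<alpha> e1"
abbreviation "a2 \<equiv> \<alpha> e2"

lemma a1: "a1 \<in> M 1" "m a1 = sM x1 1" and a2: "a2 \<in> M 1" "m a2 = sM x2 1"
  using e1 e2 \<alpha>_degree by (simp_all flip: \<alpha>_d add: \<alpha>_simps \<alpha>_one)

lemma orM_add: "x \<in> M 4 \<Longrightarrow> y \<in> M 4 \<Longrightarrow> orM (x + y) = orM x + orM y"
  and orM_scale: "x \<in> M 4 \<Longrightarrow> orM (sM r x) = r * orM x"
  using orM by (auto simp: iso_on_def hom_on_def)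

lemma orM_neg: "x \<in> M 4 \<Longrightarrow> orM (- x) = - orM x"
  using orM_scale[of x "- 1"] by simp

lemma orM_diff: "x \<in> M 4 \<Longrightarrow> y \<in> M 4 \<Longrightarrow> orM (x - y) = orM x - orM y"
  using orM_add[of x "- y"] by (simp add: orM_neg M.F_neg)

lemma orM_zero: "orM 0 = 0"
  using orM_scale[of 0 0] M.F_zero by simp

lemma orM_sum: "(\<And>j. j \<in> J \<Longrightarrow> f j \<in> M 4) \<Longrightarrow> orM (sum f J) = (\<Sum>j\<in>J. orM (f j))"
  by (induction J rule: infinite_finite_induct) (auto simp: orM_zero orM_add M.F_sum)

lemma orM_inject: "x \<in> M 4 \<Longrightarrow> y \<in> M 4 \<Longrightarrow> orM x = orM y \<Longrightarrow> x = y"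
  using orM by (auto simp: iso_on_def bij_betw_def inj_on_def)

lemma orM_surj: "\<exists>x\<in>M 4. orM x = r"
  using orM unfolding iso_on_def bij_betw_def by (metis UNIV_I imageE)

lemma orK_add: "x \<in> K 4 \<Longrightarrow> y \<in> K 4 \<Longrightarrow> orK (x + y) = orK x + orK y"
  and orK_scale: "x \<in> K 4 \<Longrightarrow> orK (sK r x) = r * orK x"
  using orK by (auto simp: iso_on_def hom_on_def)

lemma orK_neg: "x \<in> K 4 \<Longrightarrow> orK (- x) = - orK x"
  using orK_scale[of x "- 1"] by simp

lemma orK_inject: "x \<in> K 4 \<Longrightarrow> y \<in> K 4 \<Longrightarrow> orK x = orK y \<Longrightarrow> x = y"
  using orK by (auto simp: iso_on_def bij_betw_def inj_on_def)

lemma M_nondegenerate: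
  assumes "i \<le> 4" "x \<in> M i" "\<And>y. y \<in> M (4 - i) \<Longrightarrow> x * y = 0"
  shows "x = 0"
proof -
  have "hom_on sM (M (4 - i)) sM (M 4) (\<lambda>_. 0)"
    by (simp add: hom_on_def M.F_zero)
  then have "\<exists>!a. a \<in> M i \<and> (\<forall>b\<in>M (4 - i). 0 = a * b)"
    using M_perfect[OF assms(1)] unfolding perfect_pairing_def by blast
  then show ?thesis using assms M.F_zero[of i] by (metis mult_zero_left)
qed

text \<open>Poincare duality for scalar-valued functionals, by means of the orientation.\<close>

lemma M_represent:
  assumes "i \<le> 4" and h: "hom_on sM (M (4 - i)) (*) UNIV h"
  shows "\<exists>x\<in>M i. \<forall>y\<in>M (4 - i). orM (x * y) = h y"
proof -
  obtain \<omega> where \<omega>: "\<omega> \<in> M 4" "orM \<omega> = 1" using orM_surj by blast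
  have "hom_on sM (M (4 - i)) sM (M 4) (\<lambda>y. sM (h y) \<omega>)"
    using h by (auto simp: hom_on_def M.scale_left_distrib M.F_scale \<omega>)
  then obtain x where "x \<in> M i" "\<forall>y\<in>M (4 - i). sM (h y) \<omega> = x * y"
    using M_perfect[OF assms(1)] unfolding perfect_pairing_def by blast
  then show ?thesis using \<omega> by (metis mult.right_neutral orM_scale)
qed

lemma top_degree:
  assumes "i \<le> 4"
  shows "x \<in> M i \<Longrightarrow> y \<in> M (4 - i) \<Longrightarrow> x * y \<in> M 4"
    and "x' \<in> K i \<Longrightarrow> y' \<in> K (4 - i) \<Longrightarrow> x' * y' \<in> K 4"
    and "x \<in> M i \<Longrightarrow> y' \<in> K (4 - i) \<Longrightarrow> x * \<alpha> y' \<in> M 4"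
  using assms M.mult_degree'[of x i y "4 - i" 4] K.mult_degree'[of x' i y' "4 - i" 4]
    M.mult_degree'[OF _ \<alpha>_degree, of x i y' "4 - i" 4] by simp_all

text \<open>Nondegeneracy of the pairing on \<open>K\<close> makes the defining equation of \<open>\<beta>\<close> determine it. All
  properties of \<open>\<beta>\<close> are obtained by verifying this equation for a candidate value.\<close>

lemma \<beta>_unique:
  assumes "i \<le> 4" "x \<in> M i" "z \<in> K i"
    and "\<And>y. y \<in> K (4 - i) \<Longrightarrow> orK (z * y) = orM (x * \<alpha> y)"
  shows "\<beta> i x = z"
proof -
  have "(\<beta> i x - z) * y = 0" if y: "y \<in> K (4 - i)" for y
  proof -
    have "\<beta> i x * y \<in> K 4" "z * y \<in> K 4"
      using top_degree(2)[OF assms(1) _ y] \<beta>_degree[OF assms(1,2)] assms(3) by simp_all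
    then have "\<beta> i x * y = z * y"
      using assms y by (intro orK_inject) (simp_all add: \<beta>_eq)
    then show ?thesis by (simp add: left_diff_distrib)
  qed
  then have "\<beta> i x - z = 0"
    using K_nondegenerate[OF assms(1) K.F_diff[OF \<beta>_degree[OF assms(1,2)] assms(3)]] by blast
  then show ?thesis by simp
qed

lemma \<beta>_add:
  assumes "i \<le> 4" "x \<in> M i" "y \<in> M i"
  shows "\<beta> i (x + y) = \<beta> i x + \<beta> i y"
proof (rule \<beta>_unique)
  fix z assume z: "z \<in> K (4 - i)"
  have "\<beta> i x * z \<in> K 4" "\<beta> i y * z \<in> K 4" "x * \<alpha> z \<in> M 4" "y * \<alpha> z \<in> M 4"
    using top_degree(2,3)[OF assms(1) _ z] assms \<beta>_degree[OF assms(1)] by simp_all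
  then show "orK ((\<beta> i x + \<beta> i y) * z) = orM ((x + y) * \<alpha> z)"
    using assms z by (simp add: distrib_right orK_add orM_add \<beta>_eq)
qed (use assms in \<open>simp_all add: K.F_add M.F_add \<beta>_degree\<close>)

lemma \<beta>_scale:
  assumes "i \<le> 4" "x \<in> M i"
  shows "\<beta> i (sM r x) = sK r (\<beta> i x)"
proof (rule \<beta>_unique)
  fix z assume z: "z \<in> K (4 - i)"
  have "\<beta> i x * z \<in> K 4" "x * \<alpha> z \<in> M 4"
    using top_degree(2,3)[OF assms(1) _ z] assms \<beta>_degree[OF assms(1)] by simp_all
  then show "orK (sK r (\<beta> i x) * z) = orM (sM r x * \<alpha> z)"
    using assms z by (simp add: K_scale M_scale orK_scale orM_scale \<beta>_eq)
qed (use assms in \<open>simp_all add: K.F_scale M.F_scale \<beta>_degree\<close>)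

lemma \<beta>_neg: "i \<le> 4 \<Longrightarrow> x \<in> M i \<Longrightarrow> \<beta> i (- x) = - \<beta> i x"
  using \<beta>_scale[of i x "- 1"] by simp

lemma \<beta>_diff: "i \<le> 4 \<Longrightarrow> x \<in> M i \<Longrightarrow> y \<in> M i \<Longrightarrow> \<beta> i (x - y) = \<beta> i x - \<beta> i y"
  using \<beta>_add[of i x "- y"] by (simp add: \<beta>_neg M.F_neg)

text \<open>In top degree \<open>\<alpha>\<close> is multiplication by \<open>w\<close>: the case \<open>i = 0\<close> of the definition of \<open>\<beta>\<close>.\<close>

lemma orM_\<alpha>:
  assumes "z \<in> K 4" shows "orM (\<alpha> z) = w * orK z"
  using \<beta>_eq[of 0 1 z] assms M.one_degree by (simp add: \<beta>_one K_scale orK_scale)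

lemma \<beta>_\<alpha>:
  assumes "i \<le> 4" "z \<in> K i" shows "\<beta> i (\<alpha> z) = sK w z"
proof (rule \<beta>_unique)
  fix y assume y: "y \<in> K (4 - i)"
  have "z * y \<in> K 4" using top_degree(2)[OF assms(1)] assms(2) y by simp
  then show "orK (sK w z * y) = orM (\<alpha> z * \<alpha> y)"
    by (simp add: K_scale orK_scale orM_\<alpha> flip: \<alpha>_mult)
qed (use assms in \<open>simp_all add: \<alpha>_degree K.F_scale\<close>)

text \<open>\<open>\<beta>\<close> is a chain map because both differentials are self-adjoint up to the same sign.\<close>

lemma \<beta>_m:
  assumes i: "i < 4" and x: "x \<in> M (Suc i)" shows "\<beta> i (m x) = k (\<beta> (Suc i) x)"
proof (rule \<beta>_unique)
  have \<beta>x: "\<beta> (Suc i) x \<in> K (Suc i)" using \<beta>_degree i x by simp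
  show "m x \<in> M i" "k (\<beta> (Suc i) x) \<in> K i" using x \<beta>x by (simp_all add: M.d_Suc K.d_Suc)
  fix y assume y: "y \<in> K (4 - i)"
  have ky: "k y \<in> K (4 - Suc i)" 
  proof (rule K.d_Suc)
    show "y \<in> K (Suc (4 - Suc i))" using y i by (metis Suc_diff_Suc)
  qed
  have top: "K (Suc i + (4 - i)) = {0}" "M (Suc i + (4 - i)) = {0}"
    using i K_top M_top by auto
  have deg: "x * \<alpha> (k y) \<in> M 4" "\<beta> (Suc i) x * k y \<in> K 4"
    using top_degree(2,3)[OF _ _ ky] x \<beta>x i by simp_all
  have eq: "orK (\<beta> (Suc i) x * k y) = orM (x * \<alpha> (k y))"
    using \<beta>_eq[OF _ x ky] i by simp
  show "orK (k (\<beta> (Suc i) x) * y) = orM (m x * \<alpha> y)"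
  proof (cases "even (Suc i)")
    case True
    then show ?thesis
      using K.d_adjoint_even[OF \<beta>x y _ top(1)] M.d_adjoint_even[OF x \<alpha>_degree[OF y] _ top(2)] eq deg
      by (simp add: \<alpha>_d orM_neg orK_neg)
  next
    case False
    then show ?thesis
      using K.d_adjoint_odd[OF \<beta>x y _ top(1)] M.d_adjoint_odd[OF x \<alpha>_degree[OF y] _ top(2)] eq
      by (simp add: \<alpha>_d)
  qed
qed (use i in simp)

text \<open>\<open>\<beta>\<close> is linear over \<open>K\<close>: the products on the two sides pick up the same sign when \<open>z\<close> is moved
  past an element of degree one.\<close>

lemma \<beta>2_mult_\<alpha>:
  assumes z: "z \<in> K 1" and v: "v \<in> M 1" shows "\<beta> 2 (\<alpha> z * v) = z * \<beta> 1 v"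
proof (rule \<beta>_unique)
  have \<beta>v: "\<beta> 1 v \<in> K 1" using \<beta>_degree v by simp
  show "\<alpha> z * v \<in> M 2" "z * \<beta> 1 v \<in> K 2"
    using K.mult_degree[OF z \<beta>v] M.mult_degree[OF \<alpha>_degree[OF z] v] by (simp_all add: numeral_2_eq_2)
  fix y assume y: "y \<in> K (4 - 2)"
  have zy: "z * y \<in> K (4 - 1)" using K.mult_degree[OF z y] by (simp add: numeral_3_eq_3)
  have "z * \<beta> 1 v * y = - (\<beta> 1 v * (z * y))"
    using K.comm_odd[OF z \<beta>v] by (simp add: mult.assoc)
  moreover have "\<alpha> z * v * \<alpha> y = - (v * \<alpha> (z * y))"
    using M.comm_odd[OF \<alpha>_degree[OF z] v] by (simp add: \<alpha>_mult mult.assoc)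
  moreover have "\<beta> 1 v * (z * y) \<in> K 4" "v * \<alpha> (z * y) \<in> M 4"
    using top_degree(2,3)[OF _ _ zy] v \<beta>v by simp_all
  ultimately show "orK (z * \<beta> 1 v * y) = orM (\<alpha> z * v * \<alpha> y)"
    using \<beta>_eq[OF _ v zy] by (simp add: orM_neg orK_neg)
qed simp

lemma orM_\<alpha>\<beta>:
  assumes "i \<le> 4" "x \<in> M i" "y \<in> M (4 - i)"
  shows "orM (x * \<alpha> (\<beta> (4 - i) y)) = orK (\<beta> i x * \<beta> (4 - i) y)"
  using \<beta>_eq[of i x "\<beta> (4 - i) y"] \<beta>_degree[of "4 - i" y] assms by simp

lemma module_mult: "module ((*) :: 'a \<Rightarrow> 'a \<Rightarrow> 'a)"
  by unfold_locales (simp_all add: algebra_simps)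

lemma c_add: "b \<in> B \<Longrightarrow> u \<in> M 1 \<Longrightarrow> v \<in> M 1 \<Longrightarrow> c b (u + v) = c b u + c b v"
  and c_scale: "b \<in> B \<Longrightarrow> v \<in> M 1 \<Longrightarrow> c b (sM r v) = r * c b v"
  using c_hom by (simp_all add: hom_on_def)

text \<open>A homomorphism that kills \<open>\<alpha>(K\<^sub>1)\<close> factors through the coordinates.\<close>

lemma coordinate_expansion:
  assumes h: "hom_on sM (M 1) s C h" and s: "module s"
    and zero: "\<And>z. z \<in> K 1 \<Longrightarrow> h (\<alpha> z) = 0" and v: "v \<in> M 1"
  shows "h v = (\<Sum>b\<in>B. s (c b v) (h b))"
proof -
  obtain z where z: "z \<in> K 1" "v = \<alpha> z + (\<Sum>b\<in>B. sM (c b v) b)"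
    using c_expand[OF v] by blast
  have in_M: "(\<Sum>b\<in>B. sM (c b v) b) \<in> M 1"
    using B_degree by (intro M.F_sum M.F_scale) auto
  have "h v = h (\<alpha> z) + h (\<Sum>b\<in>B. sM (c b v) b)"
    using h z(1) in_M \<alpha>_degree by (subst z(2)) (simp add: hom_on_def)
  also have "h (\<Sum>b\<in>B. sM (c b v) b) = (\<Sum>b\<in>B. s (c b v) (h b))"
    using B_degree by (intro hom_on_lincomb[OF h M.module_axioms s M.F_subspace]) auto
  finally show ?thesis using zero z(1) by simp
qed

lemma coordinate_hom:
  assumes "\<And>b. b \<in> B \<Longrightarrow> g b \<in> M i"
  shows "hom_on sM (M 1) sM (M i) (\<lambda>v. \<Sum>b\<in>B. sM (c b v) (g b))"
  unfolding hom_on_def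
  by (simp add: c_add c_scale M.scale_left_distrib sum.distrib M.scale_sum_right
      M.F_sum M.F_scale assms)

text \<open>\<open>\<beta>\<^sub>3\<close> is dual to \<open>\<alpha>\<^sub>1\<close>, which has a left inverse \<open>q\<close>. The functional \<open>[z \<cdot> q(v)]\<close> on \<open>M\<^sub>1\<close> is
  represented by an element of \<open>M\<^sub>3\<close>, and that element is a preimage of \<open>z\<close>.\<close>

lemma \<beta>3_surj:
  assumes z: "z \<in> K 3" shows "\<exists>x\<in>M 3. \<beta> 3 x = z"
proof -
  define P where "P v = (\<Sum>b\<in>B. sM (c b v) b)" for v
  \<comment> \<open>\<open>q\<close> inverts \<open>\<alpha>\<close> on the component of \<open>v\<close> in \<open>\<alpha>(K\<^sub>1)\<close>.\<close>
  define q where "q v = (THE y. y \<in> K 1 \<and> v = \<alpha> y + P v)" for v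
  have q_unique: "q v = y" if "y \<in> K 1" "v = \<alpha> y + P v" for v y
    unfolding q_def
  proof (rule the_equality)
    fix y' assume "y' \<in> K 1 \<and> v = \<alpha> y' + P v"
    then show "y' = y"
      using that \<alpha>_inj by (metis add_right_cancel inj_onD)
  qed (use that in simp)
  have q: "q v \<in> K 1" "v = \<alpha> (q v) + P v" if v: "v \<in> M 1" for v
  proof -
    obtain y where y: "y \<in> K 1" "v = \<alpha> y + P v"
      using c_expand[OF v] unfolding P_def by blast
    then show "q v \<in> K 1" "v = \<alpha> (q v) + P v" using q_unique[OF y] by simp_all
  qed
  have P_hom: "hom_on sM (M 1) sM (M 1) P"
    unfolding P_def using coordinate_hom[of "\<lambda>b. b" 1] B_degree by auto
  have q_add: "q (u + v) = q u + q v" if "u \<in> M 1" "v \<in> M 1" for u v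
  proof (rule q_unique)
    have "P (u + v) = P u + P v" using P_hom that unfolding hom_on_def by simp
    then show "u + v = \<alpha> (q u + q v) + P (u + v)"
      using q(2)[OF that(1)] q(2)[OF that(2)] by (simp add: \<alpha>_simps algebra_simps)
  qed (use q(1) that in \<open>blast intro: K.F_add\<close>)
  have q_scale: "q (sM r v) = sK r (q v)" if "v \<in> M 1" for r v
  proof (rule q_unique)
    have "P (sM r v) = sM r (P v)" using P_hom that unfolding hom_on_def by simp
    then show "sM r v = \<alpha> (sK r (q v)) + P (sM r v)"
      using q(2)[OF that] by (metis \<alpha>_simps(2) M.scale_right_distrib)
  qed (use q(1) that in \<open>blast intro: K.F_scale\<close>)
  have zq: "z * q v \<in> K 4" if "v \<in> M 1" for v
    using top_degree(2)[of 3 z "q v"] z q(1)[OF that] by simp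
  have "hom_on sM (M (4 - 3)) (*) UNIV (\<lambda>v. orK (z * q v))"
    by (simp add: hom_on_def q_add q_scale distrib_left K_scale orK_add orK_scale zq)
  then obtain x where x: "x \<in> M 3" "\<forall>v\<in>M (4 - 3). orM (x * v) = orK (z * q v)"
    using M_represent[of 3] by auto
  have "\<beta> 3 x = z"
  proof (rule \<beta>_unique)
    fix y assume y: "y \<in> K (4 - 3)"
    have "P (\<alpha> y) = 0" using y c_\<alpha> by (simp add: P_def)
    then have "q (\<alpha> y) = y" using y by (intro q_unique) simp_all
    then show "orK (z * y) = orM (x * \<alpha> y)" using x(2) \<alpha>_degree[OF y] by simp
  qed (use x z in simp_all)
  then show ?thesis using x by blast
qed

section \<open>Lifts orthogonal to the image of the Koszul complex\<close>

text \<open>The condition \<open>\<beta>\<^sub>2 X = 0\<close> is equivalent to \<open>X\<^sup>\<dagger>\<close> vanishing on \<open>\<alpha>(K\<^sub>2)\<close>.\<close>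

definition is_lift :: "('m \<Rightarrow> 'm) \<Rightarrow> bool" where
  "is_lift X \<longleftrightarrow> hom_on sM (M 1) sM (M 2) X \<and> (\<forall>z\<in>K 1. X (\<alpha> z) = 0) \<and>
     (\<forall>v\<in>M 1. m (X v) = sM w v - \<alpha> (\<beta> 1 v)) \<and> (\<forall>v\<in>M 1. \<beta> 2 (X v) = 0)"

lemma boundary_scalar:
  assumes "v \<in> M 1" obtains r where "m v = sM r 1"
  using M.d_Suc[of v 0] assms M.degree_0 by auto

text \<open>A preimage of \<open>(w - \<alpha>\<beta>)v\<close> is corrected by a boundary \<open>m y\<close>: its image under \<open>\<beta>\<^sub>2\<close> is a cycle of \<open>K\<close>,
  hence a boundary, and \<open>\<beta>\<^sub>3\<close> reaches the element that bounds it.\<close>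

lemma lift_pointwise:
  assumes v: "v \<in> M 1"
  shows "\<exists>x\<in>M 2. m x = sM w v - \<alpha> (\<beta> 1 v) \<and> \<beta> 2 x = 0"
proof -
  have \<beta>v: "\<beta> 1 v \<in> K 1" using \<beta>_degree v by simp
  obtain r where r: "m v = sM r 1" using boundary_scalar[OF v] .
  have "k (\<beta> 1 v) = sK r (sK w 1)"
    using \<beta>_m[of 0 v] v \<beta>_scale[of 0 1 r] M.one_degree by (simp add: r \<beta>_one)
  then have "m (\<alpha> (\<beta> 1 v)) = sM (r * w) 1"
    by (simp flip: \<alpha>_d add: \<alpha>_simps \<alpha>_one)
  then have "m (sM w v - \<alpha> (\<beta> 1 v)) = 0"
    by (simp add: M.d_simps r mult.commute)
  moreover have D: "sM w v - \<alpha> (\<beta> 1 v) \<in> M 1"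
    using v \<beta>v \<alpha>_degree by (intro M.F_diff M.F_scale)
  ultimately obtain x where x: "x \<in> M 2" "m x = sM w v - \<alpha> (\<beta> 1 v)"
    using M_exact[of 1] by (auto simp: numeral_2_eq_2)
  have "k (\<beta> 2 x) = \<beta> 1 (m x)" using \<beta>_m[of 1 x] x by (simp add: numeral_2_eq_2)
  also have "\<dots> = 0"
    using v \<beta>v by (simp add: x \<beta>_diff \<beta>_scale \<beta>_\<alpha> M.F_scale \<alpha>_degree)
  finally obtain z where z: "z \<in> K 3" "k z = \<beta> 2 x"
    using K_exact[of 2 "\<beta> 2 x"] \<beta>_degree x by (auto simp: numeral_3_eq_3 numeral_2_eq_2)
  obtain y where y: "y \<in> M 3" "\<beta> 3 y = z" using \<beta>3_surj[OF z(1)] by blast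
  have my: "m y \<in> M 2" using M.d_Suc[of y 2] y by simp
  have "\<beta> 2 (m y) = \<beta> 2 x" using \<beta>_m[of 2 y] y z by (simp add: numeral_3_eq_3 numeral_2_eq_2)
  then have "\<beta> 2 (x - m y) = 0" using x my by (simp add: \<beta>_diff)
  moreover have "m (x - m y) = sM w v - \<alpha> (\<beta> 1 v)" by (simp add: M.d_simps M.d_d x)
  moreover have "x - m y \<in> M 2" using x my by (simp add: M.F_diff)
  ultimately show ?thesis by blast
qed

lemma lift_exists: "\<exists>X. is_lift X"
proof -
  obtain g where g: "\<And>v. v \<in> M 1 \<Longrightarrow> g v \<in> M 2"
    "\<And>v. v \<in> M 1 \<Longrightarrow> m (g v) = sM w v - \<alpha> (\<beta> 1 v)" "\<And>v. v \<in> M 1 \<Longrightarrow> \<beta> 2 (g v) = 0"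
    using lift_pointwise by metis
  have B: "b \<in> M 1" if "b \<in> B" for b using B_degree that by blast
  note gB = g(1)[OF B] g(2)[OF B] g(3)[OF B]
  let ?X = "\<lambda>v. \<Sum>b\<in>B. sM (c b v) (g b)"
  have hom: "hom_on sM (M 1) sM (M 2) ?X"
    by (rule coordinate_hom) (rule g(1)[OF B])
  have \<beta>_hom: "hom_on sM (M 2) sK (K 2) (\<beta> 2)"
    by (simp add: hom_on_def \<beta>_add \<beta>_scale \<beta>_degree)
  have D_hom: "hom_on sM (M 1) sM (M 1) (\<lambda>v. sM w v - \<alpha> (\<beta> 1 v))"
    by (simp add: hom_on_def \<beta>_add \<beta>_scale \<beta>_degree \<alpha>_simps \<alpha>_degree M.F_diff M.F_scale
        algebra_simps M.scale_right_distrib M.scale_right_diff_distrib M.scale_left_commute)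
  have D_zero: "sM w (\<alpha> z) - \<alpha> (\<beta> 1 (\<alpha> z)) = 0" if "z \<in> K 1" for z
    using that by (simp add: \<beta>_\<alpha> \<alpha>_simps)
  have "m (?X v) = sM w v - \<alpha> (\<beta> 1 v)" if "v \<in> M 1" for v
    using coordinate_expansion[OF D_hom M.module_axioms D_zero that]
    by (simp add: M.d_simps gB)
  moreover have "\<beta> 2 (?X v) = 0" for v
    using hom_on_lincomb[OF \<beta>_hom M.module_axioms K.module_axioms M.F_subspace, of B g "\<lambda>b. c b v"]
    by (simp add: gB)
  moreover have "?X (\<alpha> z) = 0" if "z \<in> K 1" for z using that by (simp add: c_\<alpha>)
  ultimately show ?thesis using hom unfolding is_lift_def by blast
qed

lemma a1_mult_degree: "u \<in> M 1 \<Longrightarrow> a1 * u \<in> M 2"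
  using M.mult_degree[OF a1(1), of u 1] by (simp add: numeral_2_eq_2)

lemma e1_mult_degree: "z \<in> K 1 \<Longrightarrow> e1 * z \<in> K 2"
  using K.mult_degree[OF e1(1), of z 1] by (simp add: numeral_2_eq_2)

text \<open>The form \<open>s(u,v) = [a\<^sub>1 u Xv]\<close>; its skew-symmetry is what makes \<open>X\<close> and \<open>X\<^sup>\<dagger>\<close> a homotopy.\<close>

definition a1_form :: "('m \<Rightarrow> 'm) \<Rightarrow> 'm \<Rightarrow> 'm \<Rightarrow> 'a" where
  "a1_form X u v = orM (a1 * u * X v)"

context
  fixes X assumes lift: "is_lift X"
begin

lemma X_degree: "v \<in> M 1 \<Longrightarrow> X v \<in> M 2"
  and X_add: "u \<in> M 1 \<Longrightarrow> v \<in> M 1 \<Longrightarrow> X (u + v) = X u + X v"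
  and X_scale: "v \<in> M 1 \<Longrightarrow> X (sM r v) = sM r (X v)"
  and X_\<alpha>: "z \<in> K 1 \<Longrightarrow> X (\<alpha> z) = 0"
  and m_X: "v \<in> M 1 \<Longrightarrow> m (X v) = sM w v - \<alpha> (\<beta> 1 v)"
  and \<beta>_X: "v \<in> M 1 \<Longrightarrow> \<beta> 2 (X v) = 0"
  using lift by (simp_all add: is_lift_def hom_on_def)

lemma X_neg: "v \<in> M 1 \<Longrightarrow> X (- v) = - X v"
  using X_scale[of v "- 1"] by simp

lemma X_diff: "u \<in> M 1 \<Longrightarrow> v \<in> M 1 \<Longrightarrow> X (u - v) = X u - X v"
  using X_add[of u "- v"] by (simp add: X_neg M.F_neg)

text \<open>This is \<open>\<beta>\<^sub>2 X = 0\<close> read through the definition of \<open>\<beta>\<close>.\<close>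

lemma \<alpha>_mult_X:
  assumes z: "z \<in> K 2" and v: "v \<in> M 1" shows "\<alpha> z * X v = 0"
proof -
  have comm: "\<alpha> z * X v = X v * \<alpha> z"
    using M.comm_even[OF \<alpha>_degree[OF z] X_degree[OF v]] by simp
  have "orM (X v * \<alpha> z) = orM 0"
    using \<beta>_eq[of 2 "X v" z] \<beta>_X X_degree v z by (simp add: orM_zero orK_scale[of 0 0, simplified] K.F_zero)
  then have "X v * \<alpha> z = 0"
    using top_degree(3)[of 2 "X v" z] X_degree v z M.F_zero orM_inject by simp
  then show ?thesis using comm by simp
qed

lemma a1_X_degree: "u \<in> M 1 \<Longrightarrow> v \<in> M 1 \<Longrightarrow> a1 * u * X v \<in> M 4"
  using top_degree(1)[of 2 "a1 * u" "X v"] by (simp add: a1_mult_degree X_degree)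

lemma a1_form_add_left: "u \<in> M 1 \<Longrightarrow> u' \<in> M 1 \<Longrightarrow> v \<in> M 1 \<Longrightarrow>
    a1_form X (u + u') v = a1_form X u v + a1_form X u' v"
  and a1_form_add_right: "u \<in> M 1 \<Longrightarrow> v \<in> M 1 \<Longrightarrow> v' \<in> M 1 \<Longrightarrow>
    a1_form X u (v + v') = a1_form X u v + a1_form X u v'"
  and a1_form_scale_left: "u \<in> M 1 \<Longrightarrow> v \<in> M 1 \<Longrightarrow> a1_form X (sM r u) v = r * a1_form X u v"
  and a1_form_scale_right: "u \<in> M 1 \<Longrightarrow> v \<in> M 1 \<Longrightarrow> a1_form X u (sM r v) = r * a1_form X u v"
  by (simp_all add: a1_form_def X_add X_scale distrib_left distrib_right M_scale orM_add orM_scale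
      a1_X_degree)

text \<open>The form kills \<open>\<alpha>(K\<^sub>1)\<close> on both sides: on the right because \<open>X\<close> does, on the left because
  \<open>a\<^sub>1 \<cdot> \<alpha>(z)\<close> lies in \<open>\<alpha>(K\<^sub>2)\<close>, which is orthogonal to the image of \<open>X\<close>.\<close>

lemma a1_form_coordinates:
  assumes "u \<in> M 1" "v \<in> M 1"
  shows "a1_form X u v = (\<Sum>b\<in>B. \<Sum>b'\<in>B. c b u * c b' v * a1_form X b b')"
proof -
  have B: "b \<in> M 1" if "b \<in> B" for b using B_degree that by blast
  have left: "a1_form X (\<alpha> z) v = 0" if "z \<in> K 1" for z
    using \<alpha>_mult_X[OF e1_mult_degree[OF that] assms(2)] by (simp add: a1_form_def \<alpha>_mult orM_zero)
  have "hom_on sM (M 1) (*) UNIV (\<lambda>u. a1_form X u v)"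
    using assms by (simp add: hom_on_def a1_form_add_left a1_form_scale_left)
  from coordinate_expansion[OF this module_mult left assms(1)]
  have "a1_form X u v = (\<Sum>b\<in>B. c b u * a1_form X b v)" .
  moreover have "a1_form X b v = (\<Sum>b'\<in>B. c b' v * a1_form X b b')" if b: "b \<in> B" for b
  proof (rule coordinate_expansion[OF _ module_mult _ assms(2)])
    show "hom_on sM (M 1) (*) UNIV (a1_form X b)"
      using B[OF b] by (simp add: hom_on_def a1_form_add_right a1_form_scale_right)
    show "a1_form X b (\<alpha> z) = 0" if "z \<in> K 1" for z using that by (simp add: a1_form_def X_\<alpha> orM_zero)
  qed
  ultimately show ?thesis by (simp add: sum_distrib_left mult.assoc)
qed

text \<open>The element \<open>m(a\<^sub>1 a\<^sub>2 v)\<close> is \<open>x\<^sub>1 a\<^sub>2 v - x\<^sub>2 a\<^sub>1 v\<close> plus a multiple of \<open>a\<^sub>1 a\<^sub>2\<close>, and \<open>a\<^sub>1 a\<^sub>2\<close> annihilates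
  \<open>Xv\<close>. On the other hand \<open>m(a\<^sub>1 a\<^sub>2 v) \<cdot> Xv = a\<^sub>1 a\<^sub>2 v \<cdot> (w v - \<alpha>\<beta>v)\<close> is zero: \<open>v v = 0\<close>, and the
  second term becomes \<open>\<beta>v e\<^sub>1 e\<^sub>2 \<beta>v = 0\<close> in \<open>K\<close>. So \<open>x\<^sub>2 [a\<^sub>1 v Xv] = x\<^sub>1 [a\<^sub>2 v Xv]\<close>.\<close>

lemma a1_form_diagonal:
  assumes v: "v \<in> M 1" shows "\<exists>t. a1_form X v v = x1 * t"
proof -
  let ?z = "e1 * e2"
  have z: "?z \<in> K 2" using e1_mult_degree e2(1) by blast
  have \<beta>v: "\<beta> 1 v \<in> K 1" using \<beta>_degree v by simp
  obtain r where r: "m v = sM r 1" using boundary_scalar[OF v] .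
  have a12: "a1 * a2 \<in> M 2" "a1 * a2 = \<alpha> ?z" using z \<alpha>_degree[OF z] by (simp_all add: \<alpha>_mult)
  have a12v: "a1 * a2 * v \<in> M 3" using M.mult_degree'[OF a12(1) v] by simp
  have "m (a1 * a2 * v) = sM x1 (a2 * v) - sM x2 (a1 * v) + sM r (a1 * a2)"
    using M.leibniz_even[OF a12(1) v] M.leibniz_odd[OF a1(1) a2(1)]
    by (simp add: a1 a2 r M_scale left_diff_distrib)
  then have "m (a1 * a2 * v) * X v = sM x1 (a2 * v * X v) - sM x2 (a1 * v * X v)"
    using \<alpha>_mult_X[OF z v] by (simp add: a12(2) M_scale distrib_right left_diff_distrib)
  moreover have "m (a1 * a2 * v) * X v = - (a1 * a2 * v * \<alpha> (\<beta> 1 v))"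
    using M.d_adjoint_odd[OF a12v X_degree[OF v]] M_top[of 5] M.odd_square[OF v]
    by (simp add: m_X[OF v] right_diff_distrib M_scale mult.assoc)
  moreover have "a1 * a2 * v * \<alpha> (\<beta> 1 v) = 0"
  proof -
    have \<beta>3: "?z * \<beta> 1 v \<in> K 3" using K.mult_degree'[OF z \<beta>v] by simp
    have "a1 * a2 * v * \<alpha> (\<beta> 1 v) = v * \<alpha> (?z * \<beta> 1 v)"
      using M.comm_even[OF a12(1) v] by (simp add: \<alpha>_mult mult.assoc)
    moreover have "\<beta> 1 v * (?z * \<beta> 1 v) = ?z * (\<beta> 1 v * \<beta> 1 v)"
      using K.comm_even[OF \<beta>v z] by (simp only: mult.assoc[symmetric]) simp
    then have "orM (v * \<alpha> (?z * \<beta> 1 v)) = 0"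
      using \<beta>_eq[of 1 v "?z * \<beta> 1 v"] v \<beta>3 orK_scale[of 0 0] K.F_zero K.odd_square[OF \<beta>v] by simp
    then have "v * \<alpha> (?z * \<beta> 1 v) = 0"
      using orM_inject[of _ 0] top_degree(3)[of 1 v "?z * \<beta> 1 v"] v \<beta>3 M.F_zero
      by (simp add: orM_zero)
    ultimately show ?thesis by simp
  qed
  ultimately have "sM x2 (a1 * v * X v) = sM x1 (a2 * v * X v)" by simp
  moreover have "a2 * v * X v \<in> M 4"
    using top_degree(1)[of 2 "a2 * v" "X v"] M.mult_degree'[OF a2(1) v] X_degree[OF v] by simp
  ultimately have "x2 * a1_form X v v = x1 * orM (a2 * v * X v)"
    using a1_X_degree[OF v v] by (simp add: a1_form_def flip: orM_scale)
  then show ?thesis by (rule x2_regular)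
qed

lemma a1_form_polar:
  assumes "u \<in> M 1" "v \<in> M 1" shows "\<exists>t. a1_form X u v + a1_form X v u = x1 * t"
proof -
  obtain t t' t'' where "a1_form X (u + v) (u + v) = x1 * t"
    "a1_form X u u = x1 * t'" "a1_form X v v = x1 * t''"
    using a1_form_diagonal assms M.F_add by metis
  moreover have "a1_form X (u + v) (u + v) = a1_form X u u + a1_form X v v + (a1_form X u v + a1_form X v u)"
    using assms by (simp add: a1_form_add_left a1_form_add_right M.F_add)
  ultimately have "a1_form X u v + a1_form X v u = x1 * (t - t' - t'')" by (simp add: algebra_simps)
  then show ?thesis ..
qed

end

section \<open>Making the form skew-symmetric\<close>

text \<open>Poincare duality turns the bilinear form on \<open>M\<^sub>1/\<alpha>(K\<^sub>1)\<close> with matrix \<open>T\<close> into a map \<open>Y : M\<^sub>1 \<rightarrow> M\<^sub>3\<close>.\<close>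

lemma correction_exists:
  fixes T :: "'m \<Rightarrow> 'm \<Rightarrow> 'a"
  shows "\<exists>Y. hom_on sM (M 1) sM (M 3) Y \<and> (\<forall>z\<in>K 1. Y (\<alpha> z) = 0) \<and>
    (\<forall>v\<in>M 1. \<forall>z\<in>K 1. Y v * \<alpha> z = 0) \<and>
    (\<forall>u\<in>M 1. \<forall>v\<in>M 1. orM (Y v * u) = (\<Sum>b\<in>B. \<Sum>b'\<in>B. c b v * c b' u * T b b'))"
proof -
  have "\<exists>y\<in>M 3. \<forall>u\<in>M 1. orM (y * u) = (\<Sum>b'\<in>B. c b' u * T b b')" for b
  proof -
    have "hom_on sM (M (4 - 3)) (*) UNIV (\<lambda>u. \<Sum>b'\<in>B. c b' u * T b b')"
      by (simp add: hom_on_def c_add c_scale sum_distrib_left sum.distrib algebra_simps)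
    then show ?thesis using M_represent[of 3] by simp
  qed
  then obtain g where g: "\<And>b. g b \<in> M 3"
    "\<And>b u. u \<in> M 1 \<Longrightarrow> orM (g b * u) = (\<Sum>b'\<in>B. c b' u * T b b')"
    by metis
  let ?Y = "\<lambda>v. \<Sum>b\<in>B. sM (c b v) (g b)"
  have hom: "hom_on sM (M 1) sM (M 3) ?Y" by (rule coordinate_hom) (rule g(1))
  have deg: "g b * u \<in> M 4" if "u \<in> M 1" for b u
    using top_degree(1)[of 3 "g b" u] g(1) that by simp
  have or: "orM (?Y v * u) = (\<Sum>b\<in>B. \<Sum>b'\<in>B. c b v * c b' u * T b b')" if "u \<in> M 1" for u v
    using that deg[OF that]
    by (simp add: sum_distrib_right M_scale orM_sum orM_scale M.F_scale g sum_distrib_left mult.assoc)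
  have "?Y v * \<alpha> z = 0" if v: "v \<in> M 1" and z: "z \<in> K 1" for v z
  proof (rule orM_inject)
    have "?Y v \<in> M 3" using hom v unfolding hom_on_def by blast
    then show "?Y v * \<alpha> z \<in> M 4" using top_degree(3)[of 3 "?Y v" z] z by simp
    show "orM (?Y v * \<alpha> z) = orM 0"
      using or[OF \<alpha>_degree[OF z]] z by (simp add: c_\<alpha> orM_zero)
  qed (rule M.F_zero)
  then show ?thesis using hom or c_\<alpha> by (intro exI[of _ ?Y]) simp
qed

text \<open>Since \<open>a\<^sub>1 u \<cdot> Yv\<close> has degree five, \<open>a\<^sub>1 u \<cdot> m(Yv)\<close> equals \<open>- m(a\<^sub>1 u) \<cdot> Yv\<close>. Here
  \<open>m(a\<^sub>1 u) = x\<^sub>1 u - m(u) a\<^sub>1\<close>, and \<open>Yv\<close> annihilates \<open>a\<^sub>1\<close>.\<close>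

lemma corrected_lift:
  assumes X: "is_lift X" and hom: "hom_on sM (M 1) sM (M 3) Y"
    and zero: "\<forall>z\<in>K 1. Y (\<alpha> z) = 0"
    and perp: "\<forall>v\<in>M 1. \<forall>z\<in>K 1. Y v * \<alpha> z = 0"
  shows "is_lift (\<lambda>v. X v + m (Y v))"
    and "\<And>u v. u \<in> M 1 \<Longrightarrow> v \<in> M 1 \<Longrightarrow>
      a1_form (\<lambda>v. X v + m (Y v)) u v = a1_form X u v + x1 * orM (Y v * u)"
proof -
  note X_degree = X_degree[OF X]
  have Y: "Y v \<in> M 3" if "v \<in> M 1" for v using hom that unfolding hom_on_def by blast
  have mY: "m (Y v) \<in> M 2" if "v \<in> M 1" for v using M.d_Suc[of "Y v" 2] Y[OF that] by simp
  have "\<beta> 3 (Y v) = 0" if v: "v \<in> M 1" for v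
    using Y[OF v] perp v K.F_zero orK_scale[of 0 0]
    by (intro \<beta>_unique) (simp_all add: orM_zero)
  then have \<beta>_mY: "\<beta> 2 (m (Y v)) = 0" if "v \<in> M 1" for v
    using \<beta>_m[of 2 "Y v"] Y[OF that] that by (simp add: numeral_3_eq_3 K.d_simps)
  show "is_lift (\<lambda>v. X v + m (Y v))"
    unfolding is_lift_def hom_on_def
  proof (intro conjI ballI allI)
    fix u v r assume u: "u \<in> M 1" and v: "v \<in> M 1"
    show "X (u + v) + m (Y (u + v)) = X u + m (Y u) + (X v + m (Y v))"
      using hom u v by (simp add: hom_on_def X_add[OF X u v] M.d_simps)
    show "X v + m (Y v) \<in> M 2" using X_degree mY v by (simp add: M.F_add)
    show "X (sM r v) + m (Y (sM r v)) = sM r (X v + m (Y v))"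
      using hom v by (simp add: hom_on_def X_scale[OF X v] M.d_simps M.scale_right_distrib)
    show "m (X v + m (Y v)) = sM w v - \<alpha> (\<beta> 1 v)"
      by (simp add: M.d_simps M.d_d m_X[OF X v])
    show "\<beta> 2 (X v + m (Y v)) = 0"
      by (simp add: \<beta>_add X_degree[OF v] mY[OF v] \<beta>_mY[OF v] \<beta>_X[OF X v])
  qed (simp add: X_\<alpha>[OF X] zero M.d_simps)
  fix u v assume u: "u \<in> M 1" and v: "v \<in> M 1"
  obtain r where r: "m u = sM r 1" using boundary_scalar[OF u] .
  have Yu: "Y v * u \<in> M 4" using top_degree(1)[of 3 "Y v" u] Y[OF v] u by simp
  have "a1 * u * m (Y v) = - (m (a1 * u) * Y v)"
    using M.d_adjoint_even[OF a1_mult_degree[OF u] Y[OF v]] M_top[of 5] by simp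
  also have "m (a1 * u) = sM x1 u - sM r a1"
    using M.leibniz_odd[OF a1(1) u] by (simp add: a1 r M_scale)
  also have "- ((sM x1 u - sM r a1) * Y v) = sM r (a1 * Y v) - sM x1 (u * Y v)"
    by (simp add: left_diff_distrib M_scale)
  also have "a1 * Y v = 0"
    using M.comm_odd[OF a1(1) Y[OF v]] perp v e1(1) by simp
  also have "u * Y v = - (Y v * u)"
    using M.comm_odd[OF u Y[OF v]] by simp
  finally have "a1 * u * m (Y v) = sM x1 (Y v * u)" by simp
  then show "a1_form (\<lambda>v. X v + m (Y v)) u v = a1_form X u v + x1 * orM (Y v * u)"
    using a1_X_degree[OF X u v] Yu
    by (simp add: a1_form_def distrib_left orM_add orM_scale M.F_scale)
qed

text \<open>On a basis, \<open>T b b'\<close> has to satisfy \<open>x\<^sub>1(T b b' + T b' b) = - (s(b,b') + s(b',b))\<close>. On the diagonal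
  this is solved without dividing by 2, as \<open>s(b,b)\<close> itself is a multiple of \<open>x\<^sub>1\<close>; off the diagonal the
  whole correction is put on the pairs with \<open>b\<close> before \<open>b'\<close> in some enumeration \<open>g\<close>.\<close>

lemma alternating_lift_exists:
  "\<exists>X. is_lift X \<and> (\<forall>u\<in>M 1. \<forall>v\<in>M 1. a1_form X u v + a1_form X v u = 0)"
proof -
  obtain X where X: "is_lift X" using lift_exists by blast
  obtain d where d: "\<And>v. v \<in> M 1 \<Longrightarrow> a1_form X v v = x1 * d v"
    using a1_form_diagonal[OF X] by metis
  obtain t where t: "\<And>u v. u \<in> M 1 \<Longrightarrow> v \<in> M 1 \<Longrightarrow> a1_form X u v + a1_form X v u = x1 * t u v"
    using a1_form_polar[OF X] by metis
  obtain g :: "'m \<Rightarrow> nat" where g: "inj_on g B"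
    using finite_imp_inj_to_nat_seg[OF B_finite] by blast
  define T where "T b b' = (if b = b' then - d b else if g b < g b' then - t b b' else 0)" for b b'
  have T: "a1_form X b b' + a1_form X b' b + x1 * (T b' b + T b b') = 0" if b: "b \<in> B" "b' \<in> B" for b b'
  proof -
    have bM: "b \<in> M 1" "b' \<in> M 1" using b B_degree by auto
    have "g b < g b' \<or> g b' < g b" if "b \<noteq> b'"
      using g b that by (metis inj_onD linorder_neqE_nat)
    then show ?thesis
      using t[OF bM] t[OF bM(2,1)] d[OF bM(1)] by (auto simp: T_def algebra_simps)
  qed
  obtain Y where Y: "hom_on sM (M 1) sM (M 3) Y" "\<forall>z\<in>K 1. Y (\<alpha> z) = 0"
    "\<forall>v\<in>M 1. \<forall>z\<in>K 1. Y v * \<alpha> z = 0"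
    "\<And>u v. u \<in> M 1 \<Longrightarrow> v \<in> M 1 \<Longrightarrow>
      orM (Y v * u) = (\<Sum>b\<in>B. \<Sum>b'\<in>B. c b v * c b' u * T b b')"
    using correction_exists[of T] by blast
  let ?X = "\<lambda>v. X v + m (Y v)"
  note corrected = corrected_lift[OF X Y(1-3)]
  have "a1_form ?X u v + a1_form ?X v u = 0" if u: "u \<in> M 1" and v: "v \<in> M 1" for u v
  proof -
    have expand: "(\<Sum>b\<in>B. \<Sum>b'\<in>B. c b v * c b' u * f b b')
        = (\<Sum>b\<in>B. \<Sum>b'\<in>B. c b u * c b' v * f b' b)" for f :: "'m \<Rightarrow> 'm \<Rightarrow> 'a"
      by (subst sum.swap) (simp add: mult_ac)
    have "a1_form ?X u v + a1_form ?X v u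
        = a1_form X u v + a1_form X v u + x1 * (orM (Y v * u) + orM (Y u * v))"
      using corrected(2)[OF u v] corrected(2)[OF v u] by (simp add: algebra_simps)
    also have "\<dots> = (\<Sum>b\<in>B. \<Sum>b'\<in>B. c b u * c b' v *
        (a1_form X b b' + a1_form X b' b + x1 * (T b' b + T b b')))"
      unfolding a1_form_coordinates[OF X u v] a1_form_coordinates[OF X v u] Y(4)[OF u v] Y(4)[OF v u]
        expand
      by (simp add: sum_distrib_left sum.distrib algebra_simps)
    also have "\<dots> = 0" using T by (simp add: algebra_simps sum.neutral)
    finally show ?thesis .
  qed
  then show ?thesis using corrected(1) by blast
qed

section \<open>The homotopy\<close>

context
  fixes X assumes lift: "is_lift X"
    and alternating: "\<And>u v. u \<in> M 1 \<Longrightarrow> v \<in> M 1 \<Longrightarrow> a1_form X u v + a1_form X v u = 0"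
begin

lemmas X_facts = X_degree[OF lift] X_add[OF lift] X_scale[OF lift] X_diff[OF lift] X_\<alpha>[OF lift]
  m_X[OF lift] \<beta>_X[OF lift]

lemma dagger_X:
  assumes "x \<in> M 2"
  shows "dagger M X x \<in> M 3" and "v \<in> M 1 \<Longrightarrow> dagger M X x * v = x * X v"
proof -
  have "hom_on sM (M 1) sM (M 2) X" using lift by (simp add: is_lift_def)
  moreover have "perfect_pairing sM (M 3) (M 1) (M 4)" using M_perfect[of 3] by simp
  ultimately have "\<exists>!y. y \<in> M 3 \<and> (\<forall>v\<in>M 1. y * v = x * X v)"
    using assms by (intro M.dagger_unique)
  then have "dagger M X x \<in> M 3 \<and> (\<forall>v\<in>M 1. dagger M X x * v = x * X v)"
    unfolding dagger_def by (rule theI')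
  then show "dagger M X x \<in> M 3" "v \<in> M 1 \<Longrightarrow> dagger M X x * v = x * X v" by blast+
qed

lemma dagger_\<alpha>:
  assumes z: "z \<in> K 2" shows "dagger M X (\<alpha> z) = 0"
proof (rule M_nondegenerate)
  show "dagger M X (\<alpha> z) * v = 0" if "v \<in> M (4 - 3)" for v
    using dagger_X(2)[OF \<alpha>_degree[OF z], of v] \<alpha>_mult_X[OF lift z, of v] that by simp
qed (simp_all add: dagger_X(1)[OF \<alpha>_degree[OF z]])

text \<open>The pairing of \<open>(w - \<alpha>\<^sub>2\<beta>\<^sub>2 - X m\<^sub>2 - m\<^sub>3 X\<^sup>\<dagger>)(x)\<close> with \<open>y\<close>, written so that its symmetry is visible.\<close>

definition homotopy_error :: "'m \<Rightarrow> 'm \<Rightarrow> 'a" where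
  "homotopy_error x y = w * orM (x * y) - orK (\<beta> 2 x * \<beta> 2 y) - orM (X (m x) * y) - orM (X (m y) * x)"

lemma m_degree: "x \<in> M 2 \<Longrightarrow> m x \<in> M 1"
  using M.d_Suc[of x 1] by (simp add: numeral_2_eq_2)

lemma degree_22: "x \<in> M 2 \<Longrightarrow> y \<in> M 2 \<Longrightarrow> x * y \<in> M 4"
  using top_degree(1)[of 2 x y] by simp

lemma \<beta>_degree_22: "x \<in> M 2 \<Longrightarrow> y \<in> M 2 \<Longrightarrow> \<beta> 2 x * \<beta> 2 y \<in> K 4"
  using top_degree(2)[of 2 "\<beta> 2 x" "\<beta> 2 y"] by (simp add: \<beta>_degree)

lemma homotopy_error_sym: "x \<in> M 2 \<Longrightarrow> y \<in> M 2 \<Longrightarrow> homotopy_error x y = homotopy_error y x"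
  using M.comm_even[of x 2 y 2] K.comm_even[of "\<beta> 2 x" 2 "\<beta> 2 y" 2]
  by (simp add: homotopy_error_def \<beta>_degree)

lemma homotopy_error_add: "x \<in> M 2 \<Longrightarrow> x' \<in> M 2 \<Longrightarrow> y \<in> M 2 \<Longrightarrow>
    homotopy_error (x + x') y = homotopy_error x y + homotopy_error x' y"
  by (simp add: homotopy_error_def distrib_left distrib_right M.d_simps X_facts m_degree \<beta>_add orM_add orK_add
      degree_22 \<beta>_degree_22 algebra_simps del: One_nat_def)

lemma homotopy_error_scale: "x \<in> M 2 \<Longrightarrow> y \<in> M 2 \<Longrightarrow> homotopy_error (sM r x) y = r * homotopy_error x y"
  by (simp add: homotopy_error_def M_scale K_scale M.d_simps X_facts m_degree \<beta>_scale orM_scale orK_scale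
      degree_22 \<beta>_degree_22 algebra_simps del: One_nat_def)

text \<open>Because \<open>m\<close> is self-adjoint up to sign and \<open>\<beta>\<close> is a chain map, moving \<open>m\<close> to the other argument turns
  the form into \<open>[x \<cdot> (w - \<alpha>\<beta> - mX)(my)]\<close>, which is zero as \<open>X\<close> lifts \<open>w - \<alpha>\<beta>\<close>.\<close>

lemma homotopy_error_boundary:
  assumes x: "x \<in> M 3" and y: "y \<in> M 2" shows "homotopy_error (m x) y = 0"
proof -
  have mx: "m x \<in> M 2" using M.d_Suc[of x 2] x by simp
  have \<beta>x: "\<beta> 3 x \<in> K 3" using \<beta>_degree x by simp
  have my: "m y \<in> M 1" and \<beta>my: "\<beta> 1 (m y) \<in> K 1" using m_degree[OF y] \<beta>_degree by simp_all
  have top: "M (3 + 2) = {0}" "K (3 + 2) = {0}" using M_top K_top by simp_all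
  have deg: "x * m y \<in> M 4" "x * \<alpha> (\<beta> 1 (m y)) \<in> M 4"
    using top_degree(1,3)[of 3 x] x my \<beta>my by simp_all
  have "orM (m x * y) = orM (x * m y)"
    using M.d_adjoint_odd[OF x y _ top(1)] by simp
  moreover have "orK (\<beta> 2 (m x) * \<beta> 2 y) = orM (x * \<alpha> (\<beta> 1 (m y)))"
  proof -
    have "\<beta> 2 (m x) = k (\<beta> 3 x)" "\<beta> 1 (m y) = k (\<beta> 2 y)"
      using \<beta>_m[of 2 x] \<beta>_m[of 1 y] x y by (simp_all add: numeral_3_eq_3 numeral_2_eq_2)
    moreover have "k (\<beta> 3 x) * \<beta> 2 y = \<beta> 3 x * k (\<beta> 2 y)"
      using K.d_adjoint_odd[OF \<beta>x \<beta>_degree[OF _ y] _ top(2)] by simp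
    ultimately have "\<beta> 2 (m x) * \<beta> 2 y = \<beta> 3 x * \<beta> 1 (m y)" by simp
    then show ?thesis using orM_\<alpha>\<beta>[of 3 x "m y"] x my by simp
  qed
  moreover have "orM (X (m y) * m x) = w * orM (x * m y) - orM (x * \<alpha> (\<beta> 1 (m y)))"
  proof -
    have "X (m y) * m x = m x * X (m y)"
      using M.comm_even[OF X_facts(1)[OF my] mx] by simp
    also have "\<dots> = x * m (X (m y))"
      using M.d_adjoint_odd[OF x X_facts(1)[OF my] _ top(1)] by simp
    finally show ?thesis
      using deg by (simp add: m_X[OF lift my] right_diff_distrib M_scale orM_diff orM_scale M.F_scale)
  qed
  moreover have "X (m (m x)) = 0" using X_facts(3)[of 0 0] M.F_zero by (simp add: M.d_d)
  ultimately show ?thesis by (simp add: homotopy_error_def orM_zero)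
qed

text \<open>Both \<open>w[a\<^sub>1 u a\<^sub>1 v]\<close> and \<open>[e\<^sub>1 \<beta>u e\<^sub>1 \<beta>v]\<close> contain a repeated odd factor. The other terms are evaluated
  from \<open>X(m(a\<^sub>1 v)) = X(x\<^sub>1 v - m(v) a\<^sub>1) = x\<^sub>1 Xv\<close>.\<close>

lemma homotopy_error_a1_multiple:
  assumes u: "u \<in> M 1" and v: "v \<in> M 1" shows "homotopy_error (a1 * u) (a1 * v) = 0"
proof -
  have \<beta>u: "\<beta> 1 u \<in> K 1" using \<beta>_degree u by simp
  have M0: "a1 * u * (a1 * v) = 0" using M.odd_repeated[OF a1(1) u] by simp
  have K0: "\<beta> 2 (a1 * u) * \<beta> 2 (a1 * v) = 0"
    using K.odd_repeated[OF e1(1) \<beta>u] \<beta>2_mult_\<alpha>[OF e1(1) u] \<beta>2_mult_\<alpha>[OF e1(1) v] by simp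
  have X: "X (m (a1 * v')) = sM x1 (X v')" if v': "v' \<in> M 1" for v'
  proof -
    obtain r where r: "m v' = sM r 1" using boundary_scalar[OF v'] .
    have "m (a1 * v') = sM x1 v' - sM r a1"
      using M.leibniz_odd[OF a1(1) v'] by (simp add: a1 r M_scale)
    then show ?thesis
      using v' a1(1) e1(1) by (simp add: X_facts M.F_scale)
  qed
  have "orM (X (m (a1 * v1)) * (a1 * v2)) = x1 * a1_form X v2 v1"
    if "v1 \<in> M 1" "v2 \<in> M 1" for v1 v2
    using M.comm_even[OF X_facts(1)[OF that(1)] a1_mult_degree[OF that(2)]]
      a1_X_degree[OF lift that(2,1)] X[OF that(1)]
    by (simp add: M_scale orM_scale a1_form_def)
  then have "homotopy_error (a1 * u) (a1 * v) = - (x1 * (a1_form X u v + a1_form X v u))"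
    using u v orK_scale[of 0 0] K.F_zero unfolding homotopy_error_def M0 K0
    by (simp add: orM_zero algebra_simps)
  then show ?thesis using alternating u v by simp
qed

text \<open>Up to a boundary, \<open>x\<^sub>1 x\<close> is \<open>a\<^sub>1 \<cdot> mx\<close>. Doing this in both arguments multiplies the form by the
  regular element \<open>x\<^sub>1\<^sup>2\<close> and reduces it to the preceding lemma.\<close>

lemma homotopy_error_zero:
  assumes x: "x \<in> M 2" and y: "y \<in> M 2" shows "homotopy_error x y = 0"
proof -
  have reduce: "x1 * homotopy_error x y = homotopy_error (a1 * m x) y" if x: "x \<in> M 2" and y: "y \<in> M 2" for x y
  proof -
    have a1x: "a1 * x \<in> M 3" using M.mult_degree'[OF a1(1) x, of 3] by simp
    have "m (a1 * x) = sM x1 x - a1 * m x"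
      using M.leibniz_odd[OF a1(1) x] by (simp add: a1 M_scale)
    then have "sM x1 x = m (a1 * x) + a1 * m x" by simp
    moreover have "m (a1 * x) \<in> M 2" using M.d_Suc[of _ 2] a1x by simp
    ultimately have "homotopy_error (sM x1 x) y = homotopy_error (m (a1 * x)) y + homotopy_error (a1 * m x) y"
      using homotopy_error_add y a1_mult_degree m_degree[OF x] by simp
    then show ?thesis using homotopy_error_scale[OF x y] homotopy_error_boundary[OF a1x y] by simp
  qed
  have ax: "a1 * m x \<in> M 2" using a1_mult_degree m_degree x by blast
  have "x1 * (x1 * homotopy_error x y) = x1 * homotopy_error y (a1 * m x)"
    using reduce[OF x y] homotopy_error_sym[OF ax y] by simp
  also have "\<dots> = homotopy_error (a1 * m y) (a1 * m x)" using reduce[OF y ax] .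
  also have "\<dots> = 0" using homotopy_error_a1_multiple m_degree x y by blast
  finally show ?thesis using x1_regular by blast
qed

lemma homotopy:
  assumes x: "x \<in> M 2"
  shows "X (m x) + m (dagger M X x) = sM w x - \<alpha> (\<beta> 2 x)"
proof -
  let ?L = "X (m x) + m (dagger M X x)" and ?R = "sM w x - \<alpha> (\<beta> 2 x)"
  have Xmx: "X (m x) \<in> M 2" and mXx: "m (dagger M X x) \<in> M 2"
    using X_facts(1) m_degree x M.d_Suc[of "dagger M X x" 2] dagger_X[OF x] by simp_all
  have \<beta>x: "\<beta> 2 x \<in> K 2" using \<beta>_degree x by simp
  have deg: "?L \<in> M 2" "?R \<in> M 2"
    using Xmx mXx x \<alpha>_degree[OF \<beta>x] by (simp_all add: M.F_add M.F_diff M.F_scale)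
  have "(?L - ?R) * y = 0" if "y \<in> M (4 - 2)" for y
  proof -
    have y: "y \<in> M 2" using that by simp
    have "m (dagger M X x) * y = dagger M X x * m y"
      using M.d_adjoint_odd[OF dagger_X(1)[OF x] y] M_top[of 5] by simp
    also have "\<dots> = X (m y) * x"
      using dagger_X(2)[OF x m_degree[OF y]] M.comm_even[OF x X_facts(1)[OF m_degree[OF y]]]
      by simp
    finally have 1: "orM (m (dagger M X x) * y) = orM (X (m y) * x)" by simp
    have "\<alpha> (\<beta> 2 x) * y = y * \<alpha> (\<beta> 2 x)"
      using M.comm_even[OF \<alpha>_degree[OF \<beta>x] y] by simp
    moreover have "\<beta> 2 x * \<beta> 2 y = \<beta> 2 y * \<beta> 2 x"
      using K.comm_even[OF \<beta>x \<beta>_degree[OF _ y]] by simp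
    ultimately have 2: "orM (\<alpha> (\<beta> 2 x) * y) = orK (\<beta> 2 x * \<beta> 2 y)"
      using orM_\<alpha>\<beta>[of 2 y x] x y by simp
    have "orM ((?L - ?R) * y) = - homotopy_error x y"
      using Xmx mXx x y \<alpha>_degree[OF \<beta>x]
      by (simp add: homotopy_error_def 1 2 left_diff_distrib distrib_right M_scale orM_diff orM_add orM_scale
          degree_22 M.F_add M.F_diff M.F_scale)
    then have "orM ((?L - ?R) * y) = orM 0" using homotopy_error_zero[OF x y] by (simp only: orM_zero minus_zero)
    then show ?thesis by (rule orM_inject[OF degree_22[OF M.F_diff[OF deg] y] M.F_zero])
  qed
  then have "?L - ?R = 0" by (intro M_nondegenerate[OF _ M.F_diff[OF deg]]) simp_all
  then show ?thesis by simp
qed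

text \<open>Evaluating the homotopy at \<open>Xv\<close> shows that \<open>X\<^sup>\<dagger>Xv\<close> is a cycle, hence the boundary of some \<open>l\<close> in
  degree four. As \<open>X a\<^sub>1 = 0\<close>, its product with \<open>a\<^sub>1\<close> is zero; but that product is \<open>- x\<^sub>1 l\<close>.\<close>

lemma dagger_X_X:
  assumes v: "v \<in> M 1" shows "dagger M X (X v) = 0"
proof -
  have Xv: "X v \<in> M 2" using X_facts(1) v .
  have \<beta>v: "\<beta> 1 v \<in> K 1" using \<beta>_degree v by simp
  have "X (m (X v)) = sM w (X v)"
    using v \<beta>v by (simp add: X_facts M.F_scale \<alpha>_degree)
  then have "m (dagger M X (X v)) = 0"
    using homotopy[OF Xv] v by (simp add: X_facts \<alpha>_simps)
  then obtain l where l: "l \<in> M 4" "m l = dagger M X (X v)"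
    using M_exact[of 3] dagger_X(1)[OF Xv] by auto
  have "m l * a1 = 0" using l dagger_X(2)[OF Xv a1(1)] e1 by (simp add: X_facts)
  moreover have "m l * a1 = - (l * m a1)"
    using M.d_adjoint_even[OF l(1) a1(1)] M_top[of 5] by simp
  ultimately have "sM x1 l = 0" by (simp add: a1 M_scale)
  then have "x1 * orM l = 0" using orM_scale[OF l(1), of x1] by (simp add: orM_zero)
  then have "l = 0" using x1_regular orM_inject[OF l(1) M.F_zero] by (simp add: orM_zero)
  then show ?thesis using l by (simp add: M.d_simps)
qed

end

end

section \<open>Coordinates from the splitting of \<open>M\<^sub>1\<close>\<close>

theorem theorem7p3:
  fixes f :: "'a::comm_ring_1" and KK :: "'a set"
    and sM :: "'a \<Rightarrow> 'm::ring_1 \<Rightarrow> 'm" and M :: "nat \<Rightarrow> 'm set"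
    and m :: "'m \<Rightarrow> 'm" and dpM :: "nat \<Rightarrow> 'm \<Rightarrow> 'm"
    and sK :: "'a \<Rightarrow> 'k::ring_1 \<Rightarrow> 'k" and K :: "nat \<Rightarrow> 'k set"
    and k :: "'k \<Rightarrow> 'k" and dpK :: "nat \<Rightarrow> 'k \<Rightarrow> 'k"
    and M11 M12 :: "'m set" and orM :: "'m \<Rightarrow> 'a" and orK :: "'k \<Rightarrow> 'a"
    and \<alpha> :: "'k \<Rightarrow> 'm" and \<beta> :: "nat \<Rightarrow> 'm \<Rightarrow> 'k"
  assumes noetherian: "noetherian_base TYPE('a)"
    and f_regular: "regular_element f"
    and KK: "\<exists>xs. length xs = 4 \<and> regular_sequence xs \<and> KK = ideal_gen (set xs)"
    and M_dgGamma: "dgGamma_algebra sM M m dpM"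
    and M_length: "\<forall>i>4. M i = {0}"
    and M_resolution: "resolves sM M m (colon KK f)"
    and M_poincare: "poincare_duality sM M"
    and M1_sum: "direct_sum2 (M 1) M11 M12"
    and M11_free: "free_of_rank sM M11 4"
    and M12_free: "\<exists>n. free_of_rank sM M12 n"
    and M11_image: "m ` M11 = (\<lambda>r. sM r 1) ` KK"
    and K_koszul: "koszul_complex 4 sK K k dpK"
    and K_resolution: "resolves sK K k KK"
    and orK: "iso_on sK (K 4) (*) UNIV orK"
    and orM: "iso_on sM (M 4) (*) UNIV orM"
    and \<alpha>_hom: "dgGamma_hom sK K k dpK sM M m dpM \<alpha>"
    and \<alpha>1_iso: "iso_on sK (K 1) sM M11 (\<lambda>x. proj_onto M11 M12 (\<alpha> x))"
    and \<alpha>1_k: "\<forall>x\<in>K 1. scalar_of sM (m (proj_onto M11 M12 (\<alpha> x))) = scalar_of sK (k x)"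
    and \<alpha>1_M12: "\<forall>x\<in>K 1. proj_onto M12 M11 (\<alpha> x) = 0"
    and \<beta>_mem: "\<forall>i\<le>4. \<forall>\<theta>\<in>M i. \<beta> i \<theta> \<in> K i"
    and \<beta>_eq: "\<forall>i\<le>4. \<forall>\<theta>\<in>M i. \<forall>\<phi>\<in>K (4 - i). orK (\<beta> i \<theta> * \<phi>) = orM (\<theta> * \<alpha> \<phi>)"
  shows "\<exists>X. hom_on sM (M 1) sM (M 2) X \<and>
    (\<forall>\<phi>\<in>K 1. X (\<alpha> \<phi>) = 0) \<and>
    (\<forall>\<theta>\<in>M 1. m (X \<theta>) = sM (scalar_of sK (\<beta> 0 1)) \<theta> - \<alpha> (\<beta> 1 \<theta>)) \<and>
    (\<forall>\<theta>\<in>M 2. X (m \<theta>) + m (dagger M X \<theta>)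
               = sM (scalar_of sK (\<beta> 0 1)) \<theta> - \<alpha> (\<beta> 2 \<theta>)) \<and>
    (\<forall>\<theta>\<in>M 1. dagger M X (X \<theta>) = 0) \<and>
    (\<forall>\<phi>\<in>K 2. dagger M X (\<alpha> \<phi>) = 0)"
proof -
  interpret M: dg_algebra sM M m using M_dgGamma by (rule dgGamma_algebra.axioms)
  interpret K: dg_algebra sK K k
    using K_koszul unfolding koszul_complex_def by (blast dest: dgGamma_algebra.axioms(1))
  obtain xs where xs: "length xs = 4" "regular_sequence xs" "KK = ideal_gen (set xs)"
    using KK by blast
  interpret P: module "(*) :: 'a \<Rightarrow> 'a \<Rightarrow> 'a"
    by unfold_locales (simp_all add: algebra_simps)
  have "xs ! 0 \<in> KK" "xs ! 1 \<in> KK"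
    using xs(1) by (simp_all add: xs(3) ideal_gen_def P.span_base)
  then have "sK (xs ! 0) 1 \<in> k ` K 1" "sK (xs ! 1) 1 \<in> k ` K 1"
    using K_resolution unfolding resolves_def by simp_all
  then obtain e1 e2 where e: "e1 \<in> K 1" "k e1 = sK (xs ! 0) 1" "e2 \<in> K 1" "k e2 = sK (xs ! 1) 1"
    by (metis imageE)
  obtain B where B: "finite B" "M.independent B" "M.span B = M12"
    using M12_free unfolding free_of_rank_def by blast
  have sub: "M.subspace M11" "M.subspace M12"
    using M11_free M12_free unfolding free_of_rank_def by (metis M.subspace_span)+
  have disjoint: "M11 \<inter> M12 = {0}" "M12 \<inter> M11 = {0}"
    using M1_sum unfolding direct_sum2_def by auto
  have M1_eq: "M 1 = {a + b | a b. a \<in> M11 \<and> b \<in> M12}"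
    using M1_sum unfolding direct_sum2_def by blast
  have M12_M: "M12 \<subseteq> M 1"
    using M.subspace_0[OF sub(1)] unfolding M1_eq by force
  have proj11: "proj_onto M11 M12 (a + b) = a" and proj12: "proj_onto M12 M11 (a + b) = b"
    if "a \<in> M11" "b \<in> M12" for a b
    using proj_onto_eq[OF M.module_axioms sub disjoint(1) that]
      proj_onto_eq[OF M.module_axioms sub(2,1) disjoint(2) that(2,1)] by (simp_all add: add.commute)
  have \<alpha>: "module_hom sK sM \<alpha>" "\<And>z i. z \<in> K i \<Longrightarrow> \<alpha> z \<in> M i" "\<alpha> 1 = 1"
    "\<And>y z. \<alpha> (y * z) = \<alpha> y * \<alpha> z" "\<And>z. \<alpha> (k z) = m (\<alpha> z)"
    using \<alpha>_hom unfolding dgGamma_hom_def by (simp_all add: image_subset_iff)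
  have proj_\<alpha>: "proj_onto M11 M12 (\<alpha> z) = \<alpha> z" if z: "z \<in> K 1" for z
  proof -
    obtain a b where ab: "a \<in> M11" "b \<in> M12" "\<alpha> z = a + b"
      using \<alpha>(2)[OF z] unfolding M1_eq by blast
    have "proj_onto M12 M11 (\<alpha> z) = b" using proj12[OF ab(1,2)] by (simp add: ab(3))
    then have "b = 0" using \<alpha>1_M12 z by simp
    then show ?thesis using proj11[OF ab(1,2)] by (simp add: ab(3))
  qed
  have \<alpha>_bij: "bij_betw \<alpha> (K 1) M11"
    using \<alpha>1_iso proj_\<alpha> bij_betw_cong[of "K 1" "\<lambda>x. proj_onto M11 M12 (\<alpha> x)" \<alpha> M11]
    by (simp add: iso_on_def)
  define c where "c b v = M.representation B (proj_onto M12 M11 v) b" for b v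
  have c_eq: "c b (a + y) = M.representation B y b" if "a \<in> M11" "y \<in> M12" for a y b
    using proj12[OF that] by (simp add: c_def)
  have c_hom: "hom_on sM (M 1) (*) UNIV (c b)" for b
    unfolding hom_on_def
  proof (intro conjI ballI allI)
    fix u v r assume "u \<in> M 1" "v \<in> M 1"
    then obtain a y a' y' where uv: "a \<in> M11" "y \<in> M12" "u = a + y" "a' \<in> M11" "y' \<in> M12" "v = a' + y'"
      unfolding M1_eq by blast
    have "u + v = (a + a') + (y + y')" and scale: "sM r v = sM r a' + sM r y'"
      by (simp_all add: uv M.scale_right_distrib)
    then have "c b (u + v) = c b ((a + a') + (y + y'))" by simp
    then show "c b (u + v) = c b u + c b v"
      using uv B M.subspace_add[OF sub(1), of a a'] M.subspace_add[OF sub(2), of y y']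
      by (simp add: c_eq M.representation_add)
    show "c b (sM r v) = r * c b v"
      unfolding scale using uv B
        M.subspace_scale[OF sub(1), of a' r] M.subspace_scale[OF sub(2), of y' r]
      by (simp add: c_eq M.representation_scale)
  qed simp
  have c_\<alpha>: "c b (\<alpha> z) = 0" if "z \<in> K 1" for b z
    using \<alpha>1_M12 that by (simp add: c_def M.representation_zero)
  have c_expand: "\<exists>z\<in>K 1. v = \<alpha> z + (\<Sum>b\<in>B. sM (c b v) b)" if "v \<in> M 1" for v
  proof -
    obtain a y where ay: "a \<in> M11" "y \<in> M12" "v = a + y" using \<open>v \<in> M 1\<close> unfolding M1_eq by blast
    have "(\<Sum>b\<in>B. sM (c b v) b) = y"
      using M.sum_representation_eq[OF B(2), of y B] B ay by (simp add: c_eq)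
    moreover obtain z where "z \<in> K 1" "\<alpha> z = a"
      using \<alpha>_bij ay(1) unfolding bij_betw_def by blast
    ultimately show ?thesis using ay(3) by blast
  qed
  have "\<beta> 0 1 \<in> K 0" using \<beta>_mem M.one_degree by blast
  then obtain w where w: "\<beta> 0 1 = sK w 1" using K.degree_0 by blast
  have w': "scalar_of sK (\<beta> 0 1) = w"
    unfolding scalar_of_def w using K.scale_one_inj by (auto dest: injD)
  \<comment> \<open>As \<open>proj_onto M12 M11 \<circ> \<alpha>\<close> vanishes on \<open>K\<^sub>1\<close>, the projection of \<open>\<alpha>\<close> to \<open>M11\<close> is \<open>\<alpha>\<close> itself, so \<open>\<alpha>\<close>
    identifies \<open>K\<^sub>1\<close> with \<open>M11\<close>; the coordinates along \<open>M12\<close> are those of \<open>M\<^sub>1/\<alpha>(K\<^sub>1)\<close>.\<close>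
  interpret L: linked_resolution sM M m sK K k orM orK \<alpha> \<beta> w B c e1 e2 "xs ! 0" "xs ! 1"
  proof unfold_locales
    show "M i = {0}" if "4 < i" for i using M_length that by blast
    show "\<exists>y\<in>M (Suc i). m y = x" if "1 \<le> i" "x \<in> M i" "m x = 0" for i x
      using M_resolution that unfolding resolves_def by (metis (mono_tags, lifting) imageE mem_Collect_eq)
    show "\<exists>y\<in>K (Suc i). k y = z" if "1 \<le> i" "z \<in> K i" "k z = 0" for i z
      using K_resolution that unfolding resolves_def by (metis (mono_tags, lifting) imageE mem_Collect_eq)
    show "perfect_pairing sM (M i) (M (4 - i)) (M 4)" if "i \<le> 4" for i
      using poincare_duality_top[OF M_poincare _ orM that] M_length by blast
    show "K i = {0}" if "4 < i" for i using K.koszul_top[OF K_koszul that] .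
    show "z = 0" if "i \<le> 4" "z \<in> K i" "\<And>y. y \<in> K (4 - i) \<Longrightarrow> z * y = 0" for i z
      using K.koszul_nondegenerate[OF K_koszul that] .
    show "inj_on \<alpha> (K 1)" using \<alpha>_bij by (rule bij_betw_imp_inj_on)
    show "B \<subseteq> M 1" using B(3) M.span_superset M12_M by blast
    show "r = 0" if "xs ! 0 * r = 0" for r
      using regular_sequence_two(1)[OF xs(2) _ that] xs(1) by simp
    show "\<exists>t. r = xs ! 0 * t" if "xs ! 1 * r = xs ! 0 * s" for r s
      using regular_sequence_two(2)[OF xs(2) _ that] xs(1) by simp
    show "\<beta> i x \<in> K i" if "i \<le> 4" "x \<in> M i" for i x using \<beta>_mem that by blast
    show "orK (\<beta> i x * y) = orM (x * \<alpha> y)" if "i \<le> 4" "x \<in> M i" "y \<in> K (4 - i)" for i x y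
      using \<beta>_eq that by blast
    show "hom_on sM (M 1) (*) UNIV (c b)" for b by (fact c_hom)
    show "c b (\<alpha> z) = 0" if "z \<in> K 1" for b z using c_\<alpha>[OF that] .
  qed (fact orM orK \<alpha> w B(1) c_expand e module_hom.add[OF \<alpha>(1)] module_hom.scale[OF \<alpha>(1)])+
  obtain X where lift: "L.is_lift X"
    and alternating: "\<And>u v. u \<in> M 1 \<Longrightarrow> v \<in> M 1 \<Longrightarrow> L.a1_form X u v + L.a1_form X v u = 0"
    using L.alternating_lift_exists by blast
  show ?thesis
    unfolding w'
  proof (intro exI[of _ X] conjI ballI)
    show "hom_on sM (M 1) sM (M 2) X" using lift unfolding L.is_lift_def by blast
    show "X (\<alpha> z) = 0" if "z \<in> K 1" for z using L.X_\<alpha>[OF lift that] .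
    show "m (X v) = sM w v - \<alpha> (\<beta> 1 v)" if "v \<in> M 1" for v using L.m_X[OF lift that] .
    show "X (m x) + m (dagger M X x) = sM w x - \<alpha> (\<beta> 2 x)" if "x \<in> M 2" for x
      using L.homotopy[OF lift alternating that] .
    show "dagger M X (X v) = 0" if "v \<in> M 1" for v
      using L.dagger_X_X[OF lift alternating that] .
    show "dagger M X (\<alpha> z) = 0" if "z \<in> K 2" for z
      using L.dagger_\<alpha>[OF lift alternating that] .
  qed
qed

end
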